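(* There exists a universal constant $c>0$ such that, for every real $p$ with $1<p\le 2$ and every $f\in W^{1/p,p}(\mathbb S^1;\mathbb S^1)$, \[ |\deg f|\le c\,(p-1)\int_{\mathbb S^1}\int_{\mathbb S^1}\frac{|f(x)-f(y)|^p}{|x-y|^2}\,\mathrm{d}x\,\mathrm{d}y . \]
   Context: $\mathbb S^1=\{z\in\mathbb C:|z|=1\}$ is equipped with arclength measure (total mass $2\pi$), and $|x-y|$ is the Euclidean chordal distance in $\mathbb C$. For $1<p<\infty$, $W^{1/p,p}(\mathbb S^1;\mathbb S^1)$ is the set of measurable maps $f:\mathbb S^1\to\mathbb S^1$ (up to a.e. equality) with $\int_{\mathbb S^1}\int_{\mathbb S^1}\frac{|f(x)-f(y)|^p}{|x-y|^2}\,\mathrm{d}x\,\mathrm{d}y<\infty$; it is contained in $\mathrm{VMO}(\mathbb S^1;\mathbb S^1)$. Here $u\in\mathrm{VMO}(\mathbb S^1)$ means $\lim_{r\downarrow0}\sup_{|I|\le r}\frac1{|I|}\int_I|u-u_I|\,\mathrm{d}x=0$, where $u_I=\frac1{|I|}\int_I u\,\mathrm{d}x$ and the supremum is over arcs $I\subset\mathbb S^1$; $\mathrm{VMO}(\mathbb S^1;\mathbb S^1)$ is the set of VMO maps with values in $\mathbb S^1$. $\deg f\in\mathbb Z$ is the Brezis–Nirenberg VMO degree: the integer-valued map on $\mathrm{VMO}(\mathbb S^1;\mathbb S^1)$ that agrees with the winding number on continuous maps and is continuous with respect to BMO-convergence. Equivalently, $\deg f=\lim_{\varepsilon\to0^+}\deg(f_\varepsilon/|f_\varepsilon|)$,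 where $f_\varepsilon(x)$ is the average of $f$ over the arc of radius $\varepsilon$ centered at $x$ (for small $\varepsilon$, $f_\varepsilon$ is continuous and nowhere zero and the degree of $f_\varepsilon/|f_\varepsilon|$ does not depend on $\varepsilon$). "Universal" means that $c$ does not depend on $p$ or $f$. *)

theory Defs
  imports "HOL-Complex_Analysis.Complex_Analysis"
begin

text \<open>Arclength measure on the unit circle, on its Lebesgue (completed) sigma-algebra;
  its space is the circle itself and its total mass is \<open>2 * pi\<close>.\<close>

definition circle_measure :: "complex measure" where
  "circle_measure =
     completion (distr (restrict_space lborel {0..<2 * pi}) (restrict_space borel (sphere 0 1)) cis)"

definition sobolev_energy :: "real \<Rightarrow> (complex \<Rightarrow> complex) \<Rightarrow> ennreal" where
  "sobolev_energy p f =
     (\<integral>\<^sup>+ x. (\<integral>\<^sup>+ y. ennreal (norm (f x - f y) powr p / norm (x - y) ^ 2) \<partial>circle_measure) \<partial>circle_measure)"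

text \<open>The fractional Sobolev class of order \<open>1 / p\<close> and exponent \<open>p\<close> of maps from the circle to
  the circle.  Its elements are representatives, not classes modulo almost everywhere equality;
  their values off the circle play no role.\<close>

definition sobolev_circle_maps :: "real \<Rightarrow> (complex \<Rightarrow> complex) set" where
  "sobolev_circle_maps p =
     {f \<in> measurable circle_measure (restrict_space borel (sphere 0 1)). sobolev_energy p f < \<infinity>}"

definition circle_arc :: "complex \<Rightarrow> real \<Rightarrow> complex set" where
  "circle_arc x \<epsilon> = (\<lambda>t. x * cis t) ` {- \<epsilon>..\<epsilon>}"

definition arc_average :: "(complex \<Rightarrow> complex) \<Rightarrow> real \<Rightarrow> complex \<Rightarrow> complex" where
  "arc_average f \<epsilon> x =
     (LINT y:circle_arc x \<epsilon>|circle_measure. f y) /\<^sub>R measure circle_measure (circle_arc x \<epsilon>)"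

text \<open>Winding number, as an integer, of a continuous nowhere vanishing function on the circle.\<close>

definition circle_degree :: "(complex \<Rightarrow> complex) \<Rightarrow> int" where
  "circle_degree g = (THE n. winding_number (g \<circ> circlepath 0 1) 0 = of_int n)"

text \<open>The Brezis--Nirenberg degree.  Recall that \<open>sgn z = z / |z|\<close>.  The limit is taken in the
  discrete space \<open>int\<close>; for a circle-valued VMO map the degree on the right-hand side is constant
  for all small \<open>\<epsilon> > 0\<close>.\<close>

definition vmo_degree :: "(complex \<Rightarrow> complex) \<Rightarrow> int" where
  "vmo_degree f = Lim (at_right 0) (\<lambda>\<epsilon>. circle_degree (\<lambda>x. sgn (arc_average f \<epsilon> x)))"

end

theory Submission
  imports Defs
begin

text \<open>
  Two ideas carry the proof: smoothing reduces everything to Lipschitz maps, and for those the degree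
  is the limiting area of inscribed polygons, whose increments are estimated by a telescoping
  potential.

  Smoothing.  Write \<open>F = f \<circ> cis\<close> and let \<open>D(s)\<close> be the integral of \<open>|F(t + s) - F(t)|^p\<close> over a period
  (\<open>diff_energy\<close>); by rotation invariance the energy dominates the integral of \<open>D(s) / s^2\<close> over
  \<open>[-pi, pi)\<close>.  If \<open>u\<close> is the average of \<open>F\<close> over a window of radius \<open>\<epsilon>\<close>, then \<open>1 - |u|^2\<close> is at most
  the part of this integral with \<open>|s| \<le> 2 \<epsilon>\<close> (\<open>one_minus_norm_average_le\<close>), which tends to \<open>0\<close>.  So
  \<open>|u| \<ge> 1/2\<close> for all small \<open>\<epsilon>\<close>; by homotopy the winding number \<open>d\<close> of \<open>u / |u|\<close> does not depend on
  \<open>\<epsilon>\<close>, and it is the degree of \<open>f\<close>.  Averaging decreases \<open>D\<close> by convexity (\<open>diff_energy_average_le\<close>)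
  and normalising costs a constant factor, so the estimate for the Lipschitz map \<open>g = u / |u|\<close>
  suffices.

  Polygons.  Let \<open>S_k\<close> be twice the signed area of the closed polygon formed by the values of \<open>g\<close> at
  \<open>2^k\<close> equally spaced points.  Then \<open>S_1 = 0\<close>, and \<open>S_k\<close> tends to \<open>2 pi d\<close>.  Passing from \<open>k\<close> to
  \<open>k + 1\<close> attaches to every edge \<open>c\<close> a triangle with new sides \<open>a\<close>, \<open>b\<close>; its vertices lie on the unit
  circle, so twice its area is \<open>abc / 2\<close>.  Bounding the sum of all \<open>abc\<close> by the energy would lose the
  factor \<open>p - 1\<close>.  The gain comes from \<open>\<psi>(t) = t^p - t^3 / 48\<close>.  For \<open>p = 1\<close> this
  function is concave with \<open>\<psi>(a) + \<psi>(b) - \<psi>(a + b) = ab(a + b) / 16\<close>, and passing from \<open>t\<close> to \<open>t^p\<close>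
  lowers the left-hand side by at most \<open>3 (p - 1) (a^p + b^p)\<close>.  As \<open>\<psi>\<close> is increasing and
  \<open>c \<le> a + b\<close>, it follows (\<open>chord_product_le\<close>) that
  \<open>abc \<le> 16 (\<psi>(a) + \<psi>(b) - \<psi>(c)) + 48 (p - 1) (a^p + b^p)\<close>,
  the potential terms telescope over the levels, and with \<open>A_k\<close> the sum of the \<open>p\<close>-th powers of the
  edges at level \<open>k\<close> one obtains
  \<open>|S_K| \<le> 8 A_K + 24 (p - 1) (A_2 + \<dots> + A_K)\<close> (\<open>polygon_area_le\<close>).

  Averaging over the starting point of the polygon turns \<open>A_k\<close> into a multiple of \<open>D(h) / h\<close> with
  \<open>h = 2 pi / 2^k\<close>.  This is at most a constant times the integral of \<open>D(s) / s^2\<close> over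
  \<open>h/3 < s < 2h/3\<close>, and these intervals are disjoint for different \<open>k\<close>.  As \<open>g\<close> is Lipschitz and
  \<open>p > 1\<close>, the boundary term \<open>A_K\<close> disappears in the limit.
\<close>

section \<open>A telescoping bound for triangles inscribed in the unit circle\<close>

lemma one_minus_powr_le:
  fixes r q :: real
  assumes "0 \<le> r" "0 \<le> q"
  shows "r * (1 - r powr q) \<le> q"
proof (cases "r = 0")
  case False
  then have r: "r > 0" using assms by simp
  have "1 + q * ln r \<le> exp (q * ln r)" by (rule exp_ge_add_one_self)
  moreover have "r powr q = exp (q * ln r)" using r by (simp add: powr_def)
  ultimately have 1: "1 - r powr q \<le> - (q * ln r)" by linarith
  have "ln (1 / r) \<le> 1 / r - 1" by (rule ln_le_minus_one) (use r in simp)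
  then have "- ln r \<le> 1 / r" using r by (simp add: ln_div)
  then have 2: "r * (- ln r) \<le> 1" using r by (simp add: field_simps)
  have "r * (1 - r powr q) \<le> r * (- (q * ln r))" using 1 r by (intro mult_left_mono) auto
  also have "\<dots> = q * (r * (- ln r))" by simp
  also have "\<dots> \<le> q * 1" using 2 assms by (intro mult_left_mono) auto
  finally show ?thesis by simp
qed (use assms in simp)

lemma two_powr_le:
  fixes q :: real assumes "0 \<le> q" "q \<le> 1" shows "2 powr q \<le> 1 + q"
proof -
  have "(1::real) powr (1 - q) * 2 powr q \<le> (1 - q) * 1 + q * 2"
    by (rule Youngs_inequality_0) (use assms in auto)
  then show ?thesis by simp
qed

text \<open>At \<open>p = 1\<close> both sides agree, and the error is linear in \<open>p - 1\<close> uniformly in the ratio of the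
  summands, because \<open>r (1 - r^q) \<le> q\<close> for \<open>0 \<le> r\<close>.\<close>

lemma powr_add_le:
  fixes a b p :: real
  assumes "0 \<le> a" "0 \<le> b" "1 < p" "p \<le> 2"
  shows "(a + b) powr p \<le> (1 + 3 * (p - 1)) * (a powr p + b powr p)"
proof -
  have main: "(a + b) powr p \<le> a powr p + b powr p + 3 * ((p - 1) * a powr p)"
    if ab: "0 < b" "b \<le> a" for a b :: real
  proof -
    \<comment> \<open>Normalise the larger summand to \<open>1\<close>; the smaller one becomes the ratio \<open>r\<close>.\<close>
    define q where "q = p - 1"
    define r where "r = b / a"
    have a: "a > 0" using ab by simp
    have b: "b = a * r" and r: "0 < r" "r \<le> 1" using a ab by (auto simp: r_def field_simps)
    have q: "0 < q" "q \<le> 1" and p: "p = 1 + q" using assms by (auto simp: q_def)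
    have "(1 + r) powr p = (1 + r) * (1 + r) powr q" using r by (simp add: p powr_add)
    also have "\<dots> \<le> (1 + r) * (2 powr q)" using r q by (intro mult_left_mono powr_mono2) auto
    also have "\<dots> \<le> (1 + r) * (1 + q)" using two_powr_le[of q] q r by (intro mult_left_mono) auto
    also have "\<dots> = 1 + q + r * q + r * (1 - r powr q) + r * r powr q" by (simp add: algebra_simps)
    also have "\<dots> \<le> 1 + q + q + q + r * r powr q"
      using one_minus_powr_le[of r q] r q mult_right_mono[of r 1 q] by linarith
    also have "r * r powr q = r powr p" using r by (simp add: p powr_add)
    finally have *: "(1 + r) powr p \<le> 1 + r powr p + 3 * q" by simp
    have "(a + b) powr p = a powr p * (1 + r) powr p"
      using a r by (subst powr_mult[symmetric]) (auto simp: b algebra_simps)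
    also have "\<dots> \<le> a powr p * (1 + r powr p + 3 * q)" by (intro mult_left_mono *) auto
    also have "\<dots> = a powr p + b powr p + 3 * q * a powr p"
      using a r by (simp add: b powr_mult algebra_simps)
    finally show ?thesis by (simp add: q_def algebra_simps)
  qed
  have split: "(1 + 3 * (p - 1)) * (a powr p + b powr p)
      = a powr p + b powr p + 3 * ((p - 1) * a powr p) + 3 * ((p - 1) * b powr p)"
    by (simp add: algebra_simps)
  have pos: "0 \<le> (p - 1) * x powr p" for x using assms by simp
  show ?thesis
  proof (cases "a = 0 \<or> b = 0")
    case True
    then show ?thesis using assms pos[of a] pos[of b] by (auto simp: algebra_simps)
  next
    case False
    then have "a > 0" "b > 0" using assms by auto
    then show ?thesis
      using main[of b a] main[of a b] pos[of a] pos[of b] unfolding split add.commute[of b a]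
      by linarith
  qed
qed

text \<open>For \<open>p = 1\<close> the cubic correction leaves a function whose deficit of additivity,
  \<open>ab(a + b) / 16\<close>, controls the areas of inscribed triangles.  The factor \<open>1/48\<close> is small enough for
  monotonicity up to \<open>4\<close>, the largest possible sum of two chords.\<close>

definition chord_potential :: "real \<Rightarrow> real \<Rightarrow> real" where
  "chord_potential p t = t powr p - t ^ 3 / 48"

lemma power3_le_powr:
  fixes x p :: real
  assumes "0 \<le> x" "x \<le> 4" "1 < p" "p \<le> 2"
  shows "x ^ 3 \<le> 16 * x powr p" and "x ^ 2 \<le> 16 * x powr (p - 1)"
proof -
  have "x powr (3 - p) \<le> 4 powr (3 - p)" using assms by (intro powr_mono2) auto
  also have "\<dots> \<le> 4 powr 2" using assms by (intro powr_mono) auto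
  finally have b: "x powr (3 - p) \<le> 16" by simp
  have "x powr 3 = x powr p * x powr (3 - p)" by (simp flip: powr_add)
  also have "\<dots> \<le> x powr p * 16" using b by (intro mult_left_mono) auto
  finally show "x ^ 3 \<le> 16 * x powr p" using assms by (cases "x = 0") auto
  have "x powr 2 = x powr (p - 1) * x powr (3 - p)" by (simp flip: powr_add)
  also have "\<dots> \<le> x powr (p - 1) * 16" using b by (intro mult_left_mono) auto
  finally show "x ^ 2 \<le> 16 * x powr (p - 1)" using assms by (cases "x = 0") auto
qed

lemma chord_potential_mono:
  assumes "0 \<le> c" "c \<le> s" "s \<le> 4" "1 < p" "p \<le> 2"
  shows "chord_potential p c \<le> chord_potential p s"
proof (cases "c = 0")
  case True
  have "s ^ 3 \<le> s powr p * 48"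
    using power3_le_powr(1)[of s p] powr_ge_zero[of s p] assms by linarith
  then show ?thesis using True by (simp add: chord_potential_def)
next
  case False
  then have c: "c > 0" "s > 0" using assms by auto
  have "s ^ 3 - c ^ 3 = (s - c) * (s ^ 2 + s * c + c ^ 2)"
    by (simp add: algebra_simps power2_eq_square power3_eq_cube)
  also have "\<dots> \<le> (s - c) * (s ^ 2 + s * s + s ^ 2)"
    using assms by (intro mult_left_mono add_mono power_mono) auto
  also have "\<dots> = (s - c) * (3 * s ^ 2)" by (simp add: power2_eq_square)
  also have "\<dots> \<le> (s - c) * (3 * (16 * s powr (p - 1)))"
    using assms power3_le_powr(2)[of s p] by (intro mult_left_mono) auto
  also have "\<dots> = 48 * (s powr p - s powr (p - 1) * c)"
    using c by (simp add: powr_diff field_simps)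
  finally have 1: "s ^ 3 - c ^ 3 \<le> 48 * (s powr p - s powr (p - 1) * c)" .
  have "c powr p = c powr (p - 1) * c" using c by (simp add: powr_diff)
  also have "\<dots> \<le> s powr (p - 1) * c"
    using assms by (intro mult_right_mono powr_mono2) auto
  finally have "48 * (s powr p - s powr (p - 1) * c) \<le> 48 * (s powr p - c powr p)" by simp
  then have "s ^ 3 - c ^ 3 \<le> 48 * (s powr p - c powr p)" using 1 by (rule order.trans[rotated])
  then show ?thesis by (simp add: chord_potential_def)
qed

text \<open>The key inequality.  Expanding \<open>(a + b)^3\<close>, the cubic part of the potential produces
  \<open>3ab(a + b) / 48\<close>, while the deficit of \<open>t^p\<close> is of order \<open>p - 1\<close>.  Monotonicity of the potential
  allows \<open>c\<close> instead of \<open>a + b\<close>.\<close>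

lemma chord_product_le:
  assumes "0 \<le> a" "a \<le> 2" "0 \<le> b" "b \<le> 2" "0 \<le> c" "c \<le> a + b" "1 < p" "p \<le> 2"
  shows "a * b * c \<le> 16 * (chord_potential p a + chord_potential p b - chord_potential p c
           + 3 * (p - 1) * (a powr p + b powr p))"
proof -
  define X where "X = (p - 1) * (a powr p + b powr p)"
  have X: "3 * (p - 1) * (a powr p + b powr p) = 3 * X" by (simp add: X_def)
  have "chord_potential p c \<le> chord_potential p (a + b)"
    using assms by (intro chord_potential_mono) auto
  also have "\<dots> = (a + b) powr p - (a ^ 3 + b ^ 3 + 3 * (a * b * (a + b))) / 48"
    by (simp add: chord_potential_def power3_eq_cube algebra_simps)
  also have "\<dots> \<le> (1 + 3 * (p - 1)) * (a powr p + b powr p) - (a ^ 3 + b ^ 3 + 3 * (a * b * c)) / 48"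
  proof -
    have "a * b * c \<le> a * b * (a + b)" using assms by (intro mult_left_mono) auto
    then have "(a ^ 3 + b ^ 3 + 3 * (a * b * c)) / 48 \<le> (a ^ 3 + b ^ 3 + 3 * (a * b * (a + b))) / 48"
      by simp
    then show ?thesis using powr_add_le[of a b p] assms by linarith
  qed
  finally have "chord_potential p c \<le> (a powr p + b powr p + 3 * X)
      - (a ^ 3 / 48 + b ^ 3 / 48 + a * b * c / 16)"
    unfolding X_def by (simp add: field_simps)
  then show ?thesis unfolding X by (simp add: chord_potential_def field_simps)
qed

text \<open>The expression on the left is twice the area of the triangle \<open>u\<close>, \<open>v\<close>, \<open>w\<close>; this is the formula
  \<open>abc / (4R)\<close> for the area with circumradius \<open>R = 1\<close>.  On the unit circle conjugation is inversion, so
  twice the area is a rational function of the vertices that factors into the three differences.\<close>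

lemma inscribed_triangle_area:
  fixes u v w :: complex
  assumes "norm u = 1" "norm v = 1" "norm w = 1"
  shows "\<bar>Im (cnj u * v) + Im (cnj v * w) - Im (cnj u * w)\<bar>
           = norm (v - u) * norm (w - v) * norm (w - u) / 2"
proof -
  define z where "z = cnj (v - u) * (w - v)"
  have nz: "u \<noteq> 0" "v \<noteq> 0" "w \<noteq> 0" using assms by auto
  have inv: "cnj x = 1 / x" if "norm x = 1" for x :: complex
  proof -
    have "x * cnj x = 1" using complex_norm_square[of x] that by simp
    moreover have "x \<noteq> 0" using that by auto
    ultimately show ?thesis by (simp add: divide_inverse inverse_unique)
  qed
  note c = inv[OF assms(1)] inv[OF assms(2)] inv[OF assms(3)]
  have vv: "cnj v * v = 1" using nz by (simp add: c)
  have "z = cnj v * w - cnj v * v - cnj u * w + cnj u * v"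
    by (simp add: z_def algebra_simps)
  then have z: "Im z = Im (cnj u * v) + Im (cnj v * w) - Im (cnj u * w)"
    unfolding vv by simp
  have "z - cnj z = - ((v - u) * (w - v) * (w - u) / (u * v * w))"
    using nz unfolding z_def by (simp add: c field_simps)
  moreover have "z - cnj z = 2 * \<i> * of_real (Im z)" by (simp add: complex_eq_iff)
  ultimately have "norm (2 * \<i> * of_real (Im z)) = norm ((v - u) * (w - v) * (w - u) / (u * v * w))"
    by (metis norm_minus_cancel)
  then have "2 * \<bar>Im z\<bar> = norm (v - u) * norm (w - v) * norm (w - u)"
    using assms by (simp add: norm_mult norm_divide)
  then show ?thesis by (simp add: z)
qed

section \<open>Areas of dyadic polygons and the winding number\<close>

lemma sum_lessThan_pairs:
  fixes \<phi> :: "nat \<Rightarrow> 'a::comm_monoid_add"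
  shows "(\<Sum>i<2 * n. \<phi> i) = (\<Sum>i<n. \<phi> (2 * i) + \<phi> (2 * i + 1))"
  by (induction n) (auto simp: ac_simps)

text \<open>\<open>S k\<close> is twice the signed area of the polygon with \<open>2 ^ k\<close> vertices.  It vanishes for the two-gon
  at level \<open>1\<close>, and the potentials of the edges telescope when the levels are summed.\<close>

lemma polygon_area_le:
  fixes g :: "real \<Rightarrow> complex" and p t :: real
  assumes unit: "\<And>x. norm (g x) = 1" and per: "\<And>x. g (x + 2 * pi) = g x"
    and p: "1 < p" "p \<le> 2"
  defines "v \<equiv> \<lambda>k i. g (t + 2 * pi * real i / 2 ^ k)"
  defines "S \<equiv> \<lambda>k. \<Sum>i<2 ^ k. Im (cnj (v k i) * v k (Suc i))"
  defines "A \<equiv> \<lambda>k. \<Sum>i<2 ^ k. norm (v k (Suc i) - v k i) powr p"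
  assumes "1 \<le> K"
  shows "\<bar>S K\<bar> \<le> 8 * A K + 24 * (p - 1) * (\<Sum>k\<in>{2..K}. A k)"
proof -
  define Q where "Q = (\<lambda>k. \<Sum>i<2 ^ k. chord_potential p (norm (v k (Suc i) - v k i)))"
  have chord2: "norm (v k i - v l j) \<le> 2" for k i l j
    using norm_triangle_ineq4[of "v k i" "v l j"] unit by (simp add: v_def)
  have refine: "v (Suc k) (2 * i) = v k i" for k i
  proof -
    have "2 * pi * real (2 * i) / 2 ^ Suc k = 2 * pi * real i / 2 ^ k" by simp
    then show ?thesis unfolding v_def by (simp only:)
  qed
  have refine': "v (Suc k) (Suc (Suc (2 * i))) = v k (Suc i)" for k i
    using refine[of k "Suc i"] by simp
  have step: "\<bar>S (Suc k) - S k\<bar> \<le> 8 * (Q (Suc k) - Q k + 3 * (p - 1) * A (Suc k))" for k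
  proof -
    define u m w where "u = (\<lambda>i. v k i)" and "m = (\<lambda>i. v (Suc k) (2 * i + 1))"
      and "w = (\<lambda>i. v k (Suc i))"
    have pairs: "(\<Sum>i<2 ^ Suc k. \<psi> (v (Suc k) i) (v (Suc k) (Suc i)))
        = (\<Sum>i<2 ^ k. \<psi> (u i) (m i) + \<psi> (m i) (w i))" for \<psi> :: "complex \<Rightarrow> complex \<Rightarrow> real"
      by (simp add: sum_lessThan_pairs refine refine' u_def m_def w_def)
    have S: "S (Suc k) - S k = (\<Sum>i<2 ^ k. Im (cnj (u i) * m i) + Im (cnj (m i) * w i) - Im (cnj (u i) * w i))"
      unfolding S_def pairs[of "\<lambda>x y. Im (cnj x * y)"] by (simp add: u_def w_def sum_subtractf)
    have A: "A (Suc k) = (\<Sum>i<2 ^ k. norm (m i - u i) powr p + norm (w i - m i) powr p)"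
      unfolding A_def pairs[of "\<lambda>x y. norm (y - x) powr p"] ..
    have Q: "Q (Suc k) - Q k = (\<Sum>i<2 ^ k. chord_potential p (norm (m i - u i))
        + chord_potential p (norm (w i - m i)) - chord_potential p (norm (w i - u i)))"
      unfolding Q_def pairs[of "\<lambda>x y. chord_potential p (norm (y - x))"]
      by (simp add: u_def w_def sum_subtractf)
    have "\<bar>S (Suc k) - S k\<bar> \<le> (\<Sum>i<2 ^ k. norm (m i - u i) * norm (w i - m i) * norm (w i - u i) / 2)"
      unfolding S
      by (rule order.trans[OF sum_abs], rule sum_mono, subst inscribed_triangle_area)
        (auto simp: u_def m_def w_def v_def unit)
    also have "\<dots> \<le> (\<Sum>i<2 ^ k. 8 * (chord_potential p (norm (m i - u i))
        + chord_potential p (norm (w i - m i)) - chord_potential p (norm (w i - u i))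
        + 3 * (p - 1) * (norm (m i - u i) powr p + norm (w i - m i) powr p)))"
    proof (rule sum_mono)
      fix i
      have "norm (w i - u i) \<le> norm (m i - u i) + norm (w i - m i)"
        using norm_triangle_ineq[of "m i - u i" "w i - m i"] by simp
      then show "norm (m i - u i) * norm (w i - m i) * norm (w i - u i) / 2
        \<le> 8 * (chord_potential p (norm (m i - u i))
          + chord_potential p (norm (w i - m i)) - chord_potential p (norm (w i - u i))
          + 3 * (p - 1) * (norm (m i - u i) powr p + norm (w i - m i) powr p))"
        using chord_product_le[of "norm (m i - u i)" "norm (w i - m i)" "norm (w i - u i)" p] p
        by (simp add: u_def m_def w_def chord2)
    qed
    also have "\<dots> = 8 * (Q (Suc k) - Q k + 3 * (p - 1) * A (Suc k))"
      unfolding Q A by (simp only: sum_distrib_left sum.distrib[symmetric])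
    finally show ?thesis .
  qed
  \<comment> \<open>The potential at the coarsest level enters with a negative sign and may be dropped.\<close>
  have pot: "0 \<le> chord_potential p x" if "0 \<le> x" "x \<le> 2" for x
    using chord_potential_mono[of 0 x p] that p by (simp add: chord_potential_def)
  have "\<bar>S (Suc n)\<bar> \<le> 8 * Q (Suc n) + 24 * (p - 1) * (\<Sum>k\<in>{2..Suc n}. A k)" for n
  proof (induction n)
    case 0
    have "t + 2 * pi * 2 / 2 = t + 2 * pi" by simp
    then have "v 1 2 = v 1 0" using per[of t] by (simp add: v_def mult.commute)
    then have "S 1 = Im (cnj (v 1 0) * v 1 1) + Im (cnj (v 1 1) * v 1 0)"
      by (simp add: S_def numeral_2_eq_2)
    also have "\<dots> = 0" by simp
    finally have "S (Suc 0) = 0" by simp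
    moreover have "0 \<le> Q (Suc 0)" unfolding Q_def by (intro sum_nonneg pot) (auto simp: chord2)
    ultimately show ?case by simp
  next
    case (Suc n)
    then show ?case using step[of "Suc n"] by (simp add: algebra_simps)
  qed
  from this[of "K - 1"] have "\<bar>S K\<bar> \<le> 8 * Q K + 24 * (p - 1) * (\<Sum>k\<in>{2..K}. A k)"
    using \<open>1 \<le> K\<close> by simp
  moreover have "Q K \<le> A K"
    unfolding Q_def A_def chord_potential_def by (intro sum_mono) simp
  ultimately show ?thesis by simp
qed

lemma abs_sin_diff_le:
  fixes x :: real shows "\<bar>x - sin x\<bar> \<le> \<bar>x\<bar> ^ 3 / 6"
proof -
  have "\<bar>sin x - (\<Sum>m<3. sin_coeff m * x ^ m)\<bar> \<le> inverse (fact 3) * \<bar>x\<bar> ^ 3"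
    by (rule Maclaurin_sin_bound)
  also have "(\<Sum>m<3. sin_coeff m * x ^ m) = x"
    by (simp add: sin_coeff_def eval_nat_numeral)
  finally show ?thesis by (simp add: fact_numeral abs_minus_commute)
qed

lemma abs_angle_le_chord:
  fixes \<theta> :: real
  assumes "\<bar>\<theta>\<bar> \<le> pi"
  shows "\<bar>\<theta>\<bar> \<le> 2 * norm (cis \<theta> - 1)"
proof -
  define x where "x = \<theta> / 2"
  have "\<bar>x\<bar> \<le> 8 / 5" using assms pi_less_4 pi_approx(2) by (simp add: x_def)
  then have "\<bar>x\<bar> ^ 2 \<le> (8 / 5) ^ 2" by (intro power_mono) auto
  then have "\<bar>x\<bar> * \<bar>x\<bar> ^ 2 \<le> \<bar>x\<bar> * (64 / 25)" by (intro mult_left_mono) (auto simp: power2_eq_square)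
  then have "\<bar>x\<bar> ^ 3 / 6 \<le> \<bar>x\<bar> / 2" by (simp add: power3_eq_cube power2_eq_square)
  then have "\<bar>x\<bar> \<le> 2 * \<bar>sin x\<bar>" using abs_sin_diff_le[of x] by linarith
  moreover have "norm (cis \<theta> - 1) = 2 * \<bar>sin x\<bar>"
    using dist_exp_i_1[of \<theta>] by (simp add: cis_conv_exp x_def)
  ultimately show ?thesis by (simp add: x_def)
qed

text \<open>Along a continuous lift of the angle the increments \<open>\<theta>\<close> over the edges add up to \<open>2 pi d\<close>, while
  the sum of their sines is twice the polygon area.  The difference is cubic in the edges, hence
  dominated by the sum of their \<open>p\<close>-th powers.  The condition on \<open>L\<close> makes every edge shorter than a
  diameter, so that no increment can exceed \<open>pi\<close>.\<close>

lemma winding_number_le_polygon: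
  fixes g :: "real \<Rightarrow> complex" and p t L :: real and d :: int
  assumes unit: "\<And>x. norm (g x) = 1" and per: "\<And>x. g (x + 2 * pi) = g x"
    and lip: "\<And>x y. norm (g x - g y) \<le> L * \<bar>x - y\<bar>"
    and d: "winding_number (\<lambda>s. g (t + 2 * pi * s)) 0 = of_int d"
    and p: "1 < p" "p \<le> 2" and K: "1 \<le> K" "L * (2 * pi / 2 ^ K) < 2"
  defines "A \<equiv> \<lambda>k. \<Sum>i<2 ^ k. norm (g (t + 2 * pi * real (Suc i) / 2 ^ k) - g (t + 2 * pi * real i / 2 ^ k)) powr p"
  shows "2 * pi * \<bar>real_of_int d\<bar> \<le> 30 * A K + 24 * (p - 1) * (\<Sum>k\<in>{2..K}. A k)"
proof -
  define \<gamma> where "\<gamma> = (\<lambda>s. g (t + 2 * pi * s))"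
  define N where "N = (2::nat) ^ K"
  have N: "real N = 2 ^ K" "N > 0" by (auto simp: N_def)
  have "0 \<le> norm (g 1 - g 0)" by (rule norm_ge_zero)
  also have "\<dots> \<le> L" using lip[of 1 0] by simp
  finally have L: "0 \<le> L" .
  have contg: "continuous_on X g" for X
    by (rule lipschitz_on_continuous_on[of L], rule lipschitz_onI) (use lip L in \<open>auto simp: dist_norm\<close>)
  have pg: "path \<gamma>" unfolding path_def \<gamma>_def
    by (rule continuous_on_compose2[OF contg[of UNIV]]) (auto intro!: continuous_intros)
  have nz: "0 \<notin> path_image \<gamma>"
  proof
    assume "0 \<in> path_image \<gamma>"
    then obtain s where "g (t + 2 * pi * s) = 0" by (auto simp: path_image_def \<gamma>_def)
    then show False using unit[of "t + 2 * pi * s"] by simp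
  qed
  obtain q where q: "path q" "pathfinish q - pathstart q = 2 * of_real pi * \<i> * winding_number \<gamma> 0"
    and qe: "\<And>s. s \<in> {0..1} \<Longrightarrow> \<gamma> s = 0 + exp (q s)"
    by (rule winding_number_as_continuous_log[OF pg nz]) (rule that)
  define \<phi> where "\<phi> = (\<lambda>s. Im (q s))"
  have cont: "continuous_on {0..1} \<phi>" using q(1) unfolding path_def \<phi>_def by (intro continuous_intros)
  have g\<phi>: "\<gamma> s = cis (\<phi> s)" if "s \<in> {0..1}" for s
  proof -
    have "norm (exp (q s)) = 1" using qe[OF that] unit[of "t + 2 * pi * s"] by (simp add: \<gamma>_def)
    then have "Re (q s) = 0" by (simp add: norm_exp_eq_Re)
    then show ?thesis using qe[OF that] by (simp add: exp_eq_polar \<phi>_def)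
  qed
  have tot: "\<phi> 1 - \<phi> 0 = 2 * pi * d"
    using arg_cong[OF q(2), of Im] d by (simp add: \<phi>_def pathfinish_def pathstart_def \<gamma>_def)
  define \<theta> where "\<theta> = (\<lambda>i. \<phi> (real (Suc i) / N) - \<phi> (real i / N))"
  define v where "v = (\<lambda>i. g (t + 2 * pi * real i / 2 ^ K))"
  have v: "v i = cis (\<phi> (real i / N))" if "i \<le> N" for i
    using g\<phi>[of "real i / N"] that N by (simp add: \<gamma>_def v_def)
  have "(\<Sum>i<N. \<theta> i) = \<phi> (real N / N) - \<phi> (real 0 / N)"
    unfolding \<theta>_def by (rule sum_lessThan_telescope)
  then have sum\<theta>: "(\<Sum>i<N. \<theta> i) = 2 * pi * d" using tot N by simp
  have ratio: "cnj (v i) * v (Suc i) = cis (\<theta> i)" if "i < N" for i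
    using that by (simp add: v \<theta>_def cis_cnj cis_mult)
  have chord: "norm (v (Suc i) - v i) = norm (cis (\<theta> i) - 1)" if "i < N" for i
  proof -
    have "v (Suc i) - v i = v i * (cis (\<theta> i) - 1)"
      using that by (simp add: v \<theta>_def algebra_simps cis_mult)
    then show ?thesis using unit by (simp add: norm_mult v_def)
  qed
  have small: "\<bar>\<theta> i\<bar> \<le> pi" if i: "i < N" for i
  proof (rule ccontr)
    assume big: "\<not> \<bar>\<theta> i\<bar> \<le> pi"
    define a b where "a = real i / N" and "b = real (Suc i) / N"
    have ab: "0 \<le> a" "a \<le> b" "b \<le> 1" using i N(2) by (auto simp: a_def b_def field_simps)
    have cab: "continuous_on {a..b} \<phi>" using ab by (intro continuous_on_subset[OF cont]) auto
    \<comment> \<open>An increment larger than \<open>pi\<close> would pass through the antipode of its starting value.\<close>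
    obtain x where x: "a \<le> x" "x \<le> b" "\<bar>\<phi> x - \<phi> a\<bar> = pi"
    proof -
      have "continuous_on {a..b} (\<lambda>x. \<bar>\<phi> x - \<phi> a\<bar>)" by (intro continuous_intros cab)
      then have "\<exists>x\<ge>a. x \<le> b \<and> \<bar>\<phi> x - \<phi> a\<bar> = pi"
        by (intro IVT') (use ab big in \<open>auto simp: \<theta>_def a_def b_def\<close>)
      then show ?thesis using that by blast
    qed
    have "cis (\<phi> x) = cis (\<phi> a) * cis (\<phi> x - \<phi> a)" by (simp add: cis_mult)
    also have "cis (\<phi> x - \<phi> a) = -1"
    proof -
      have "\<phi> x - \<phi> a = pi \<or> \<phi> x - \<phi> a = - pi" using x(3) by linarith
      then show ?thesis by (auto simp: complex_eq_iff)
    qed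
    finally have "\<gamma> x - \<gamma> a = - 2 * cis (\<phi> a)"
      using g\<phi>[of x] g\<phi>[of a] ab x by simp
    then have "2 = norm (\<gamma> x - \<gamma> a)" by (simp add: norm_mult)
    also have "\<dots> \<le> L * \<bar>2 * pi * (x - a)\<bar>"
      unfolding \<gamma>_def using lip[of "t + 2 * pi * x" "t + 2 * pi * a"] by (simp add: algebra_simps)
    also have "\<dots> \<le> L * (2 * pi / 2 ^ K)"
    proof -
      have "b = a + 1 / N" by (simp add: a_def b_def add_divide_distrib)
      then have "x - a \<le> 1 / 2 ^ K" using x(2) N(1) by simp
      then have "2 * pi * (x - a) \<le> 2 * pi * (1 / 2 ^ K)" by (intro mult_left_mono) auto
      then show ?thesis using x(1) L by (intro mult_left_mono) auto
    qed
    finally show False using K by simp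
  qed
  define S where "S = (\<Sum>i<N. Im (cnj (v i) * v (Suc i)))"
  have "S = (\<Sum>i<N. sin (\<theta> i))" unfolding S_def by (intro sum.cong) (auto simp: ratio)
  then have "\<bar>2 * pi * d - S\<bar> = \<bar>\<Sum>i<N. \<theta> i - sin (\<theta> i)\<bar>" by (simp add: sum_subtractf sum\<theta>)
  also have "\<dots> \<le> (\<Sum>i<N. 22 * norm (v (Suc i) - v i) powr p)"
  proof (rule order.trans[OF sum_abs], rule sum_mono)
    fix i assume "i \<in> {..<N}"
    then have i: "i < N" by simp
    define \<delta> where "\<delta> = norm (v (Suc i) - v i)"
    have \<delta>: "0 \<le> \<delta>" "\<delta> \<le> 2"
      using norm_triangle_ineq4[of "v (Suc i)" "v i"] unit by (auto simp: \<delta>_def v_def)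
    have "\<delta> ^ 3 \<le> 16 * \<delta> powr p" using \<delta> p by (intro power3_le_powr) auto
    moreover have cube: "(2 * \<delta>) ^ 3 = 8 * \<delta> ^ 3" by (simp add: power_mult_distrib)
    moreover have "\<bar>\<theta> i - sin (\<theta> i)\<bar> \<le> \<bar>\<theta> i\<bar> ^ 3 / 6" by (rule abs_sin_diff_le)
    moreover have "\<bar>\<theta> i\<bar> ^ 3 \<le> (2 * \<delta>) ^ 3"
      using abs_angle_le_chord[OF small[OF i]] chord[OF i] by (intro power_mono) (auto simp: \<delta>_def)
    ultimately show "\<bar>\<theta> i - sin (\<theta> i)\<bar> \<le> 22 * norm (v (Suc i) - v i) powr p"
      unfolding \<delta>_def[symmetric] cube using powr_ge_zero[of \<delta> p] by linarith
  qed
  also have "\<dots> = 22 * A K" by (simp add: A_def v_def N_def sum_distrib_left)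
  finally have 1: "\<bar>2 * pi * d - S\<bar> \<le> 22 * A K" .
  have 2: "\<bar>S\<bar> \<le> 8 * A K + 24 * (p - 1) * (\<Sum>k\<in>{2..K}. A k)"
    unfolding S_def A_def v_def N_def using polygon_area_le[of g p K t] unit per p K by simp
  have "2 * pi * \<bar>real_of_int d\<bar> = \<bar>2 * pi * d\<bar>" by (simp add: abs_mult)
  also have "\<dots> \<le> \<bar>2 * pi * d - S\<bar> + \<bar>S\<bar>" by linarith
  finally show ?thesis using 1 2 by linarith
qed

section \<open>Integrals over a period and difference energies\<close>

lemma periodic_int:
  fixes F :: "real \<Rightarrow> 'a"
  assumes "\<And>t. F (t + 2 * pi) = F t"
  shows "F (t + 2 * pi * of_int n) = F t"
proof -
  interpret periodic_fun_simple F "2 * pi" by standard (rule assms)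
  show ?thesis using plus_of_int[of t n] by (simp add: mult.commute)
qed

lemma nn_integral_shift:
  fixes H :: "real \<Rightarrow> ennreal"
  assumes [measurable]: "H \<in> borel_measurable borel"
  shows "(\<integral>\<^sup>+ t\<in>{a + c..<b + c}. H t \<partial>lborel) = (\<integral>\<^sup>+ t\<in>{a..<b}. H (t + c) \<partial>lborel)"
proof -
  have "(\<integral>\<^sup>+ t\<in>{a + c..<b + c}. H t \<partial>lborel)
      = (\<integral>\<^sup>+ t. H (c + 1 * t) * indicator {a + c..<b + c} (c + 1 * t) \<partial>lborel)"
    by (subst nn_integral_real_affine[of _ 1 c]) auto
  also have "\<dots> = (\<integral>\<^sup>+ t\<in>{a..<b}. H (t + c) \<partial>lborel)"
    by (intro nn_integral_cong) (auto simp: indicator_def add.commute)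
  finally show ?thesis .
qed

lemma nn_integral_split:
  fixes H :: "real \<Rightarrow> ennreal"
  assumes [measurable]: "H \<in> borel_measurable borel" and "a \<le> b" "b \<le> c"
  shows "(\<integral>\<^sup>+ t\<in>{a..<c}. H t \<partial>lborel)
           = (\<integral>\<^sup>+ t\<in>{a..<b}. H t \<partial>lborel) + (\<integral>\<^sup>+ t\<in>{b..<c}. H t \<partial>lborel)"
  using assms(2,3) by (subst nn_integral_add[symmetric]) (auto intro!: nn_integral_cong simp: indicator_def)

lemma nn_integral_period:
  fixes H :: "real \<Rightarrow> ennreal"
  assumes [measurable]: "H \<in> borel_measurable borel" and per: "\<And>t. H (t + 2 * pi) = H t"
  shows "(\<integral>\<^sup>+ t\<in>{a..<a + 2 * pi}. H t \<partial>lborel) = (\<integral>\<^sup>+ t\<in>{0..<2 * pi}. H t \<partial>lborel)"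
proof -
  \<comment> \<open>Move the interval to one starting in \<open>[0, 2 pi]\<close>, cut it at \<open>2 pi\<close> and move the second piece back.\<close>
  define n where "n = \<lfloor>a / (2 * pi)\<rfloor>"
  define b where "b = a - 2 * pi * of_int n"
  have b: "0 \<le> b" "b \<le> 2 * pi"
    using floor_divide_lower[of "2 * pi" a] floor_divide_upper[of "2 * pi" a]
    by (auto simp: b_def n_def algebra_simps)
  have "(\<integral>\<^sup>+ t\<in>{a..<a + 2 * pi}. H t \<partial>lborel) = (\<integral>\<^sup>+ t\<in>{b..<b + 2 * pi}. H t \<partial>lborel)"
    using nn_integral_shift[of H b "2 * pi * of_int n" "b + 2 * pi"] periodic_int[where F = H, OF per]
    by (simp add: b_def algebra_simps)
  also have "\<dots> = (\<integral>\<^sup>+ t\<in>{b..<2 * pi}. H t \<partial>lborel) + (\<integral>\<^sup>+ t\<in>{2 * pi..<b + 2 * pi}. H t \<partial>lborel)"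
    using b by (intro nn_integral_split) auto
  also have "(\<integral>\<^sup>+ t\<in>{2 * pi..<b + 2 * pi}. H t \<partial>lborel) = (\<integral>\<^sup>+ t\<in>{0..<b}. H t \<partial>lborel)"
    using nn_integral_shift[of H 0 "2 * pi" b] by (simp add: per)
  also have "(\<integral>\<^sup>+ t\<in>{b..<2 * pi}. H t \<partial>lborel) + (\<integral>\<^sup>+ t\<in>{0..<b}. H t \<partial>lborel)
      = (\<integral>\<^sup>+ t\<in>{0..<2 * pi}. H t \<partial>lborel)"
    using b nn_integral_split[of H 0 b "2 * pi"] by (simp add: add.commute)
  finally show ?thesis .
qed

lemma nn_integral_period_shift:
  fixes H :: "real \<Rightarrow> ennreal"
  assumes [measurable]: "H \<in> borel_measurable borel" and per: "\<And>t. H (t + 2 * pi) = H t"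
  shows "(\<integral>\<^sup>+ t\<in>{0..<2 * pi}. H (t + c) \<partial>lborel) = (\<integral>\<^sup>+ t\<in>{0..<2 * pi}. H t \<partial>lborel)"
  using nn_integral_shift[of H 0 c "2 * pi"] nn_integral_period[of H c] per by (simp add: add.commute)

definition diff_energy :: "real \<Rightarrow> (real \<Rightarrow> complex) \<Rightarrow> real \<Rightarrow> ennreal" where
  "diff_energy p F s = (\<integral>\<^sup>+ t\<in>{0..<2 * pi}. ennreal (norm (F (t + s) - F t) powr p) \<partial>lborel)"

lemma borel_measurable_diff_energy [measurable]:
  assumes [measurable]: "F \<in> borel_measurable borel"
  shows "diff_energy p F \<in> borel_measurable borel"
  unfolding diff_energy_def by measurable

lemma diff_energy_shift:
  assumes [measurable]: "F \<in> borel_measurable borel" and per: "\<And>t. F (t + 2 * pi) = F t"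
  shows "(\<integral>\<^sup>+ t\<in>{0..<2 * pi}. ennreal (norm (F (t + c + s) - F (t + c)) powr p) \<partial>lborel) = diff_energy p F s"
proof -
  have "F (t + 2 * pi + s) = F (t + s)" for t using per[of "t + s"] by (simp add: algebra_simps)
  then show ?thesis unfolding diff_energy_def
    using nn_integral_period_shift[of "\<lambda>t. ennreal (norm (F (t + s) - F t) powr p)" c] per by simp
qed

lemma diff_energy_triangle:
  assumes [measurable]: "F \<in> borel_measurable borel" and per: "\<And>t. F (t + 2 * pi) = F t"
    and p: "1 < p" "p \<le> 2"
  shows "diff_energy p F h \<le> 4 * (diff_energy p F s + diff_energy p F (h - s))"
proof -
  have "diff_energy p F h \<le> (\<integral>\<^sup>+ t. 4 * (ennreal (norm (F (t + s) - F t) powr p) * indicator {0..<2 * pi} t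
      + ennreal (norm (F (t + s + (h - s)) - F (t + s)) powr p) * indicator {0..<2 * pi} t) \<partial>lborel)"
    unfolding diff_energy_def
  proof (rule nn_integral_mono)
    fix t
    define a b where "a = norm (F (t + s) - F t)" and "b = norm (F (t + h) - F (t + s))"
    have ab: "0 \<le> a" "0 \<le> b" by (auto simp: a_def b_def)
    have "norm (F (t + h) - F t) \<le> a + b"
      using norm_triangle_ineq[of "F (t + h) - F (t + s)" "F (t + s) - F t"] by (simp add: a_def b_def)
    then have "norm (F (t + h) - F t) powr p \<le> (a + b) powr p" using p by (intro powr_mono2) auto
    also have "\<dots> \<le> (1 + 3 * (p - 1)) * (a powr p + b powr p)" using ab p by (intro powr_add_le)
    also have "\<dots> \<le> 4 * (a powr p + b powr p)" using p by (intro mult_right_mono) auto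
    finally have "ennreal (norm (F (t + h) - F t) powr p) \<le> 4 * (ennreal (a powr p) + ennreal (b powr p))"
      by (simp add: ennreal_leI flip: ennreal_plus ennreal_mult' ennreal_numeral)
    then show "ennreal (norm (F (t + h) - F t) powr p) * indicator {0..<2 * pi} t
      \<le> 4 * (ennreal (norm (F (t + s) - F t) powr p) * indicator {0..<2 * pi} t
      + ennreal (norm (F (t + s + (h - s)) - F (t + s)) powr p) * indicator {0..<2 * pi} t)"
      by (simp add: a_def b_def indicator_def)
  qed
  also have "\<dots> = 4 * (diff_energy p F s + diff_energy p F (h - s))"
    using diff_energy_shift[of F s "h - s" p] per
    by (simp add: nn_integral_cmult nn_integral_add) (simp add: diff_energy_def)
  finally show ?thesis .
qed

text \<open>Splitting a step \<open>h\<close> into \<open>s\<close> and \<open>h - s\<close> and averaging over \<open>s\<close> in the middle third replaces the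
  single scale \<open>h\<close> by a band of scales.  The band is invariant under \<open>s \<mapsto> h - s\<close>, and being open it is
  disjoint from the band of \<open>h / 2\<close>.\<close>

lemma diff_energy_le_average:
  assumes [measurable]: "F \<in> borel_measurable borel" and per: "\<And>t. F (t + 2 * pi) = F t"
    and p: "1 < p" "p \<le> 2" and h: "0 < h"
  shows "ennreal (1 / h) * diff_energy p F h
    \<le> 11 * (\<integral>\<^sup>+ s\<in>{h / 3<..<2 * h / 3}. diff_energy p F s * ennreal (1 / s\<^sup>2) \<partial>lborel)"
proof -
  let ?D = "diff_energy p F" and ?I = "{h / 3<..<2 * h / 3}"
  have refl: "(\<integral>\<^sup>+ s\<in>?I. ?D (h - s) \<partial>lborel) = (\<integral>\<^sup>+ s\<in>?I. ?D s \<partial>lborel)"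
    by (subst nn_integral_real_affine[of "\<lambda>s. ?D s * indicator ?I s" "-1" h])
      (auto intro!: nn_integral_cong simp: indicator_def)
  have "ennreal (h / 3) * ?D h = (\<integral>\<^sup>+ s\<in>?I. ?D h \<partial>lborel)"
    using h by (simp add: nn_integral_cmult mult.commute)
  also have "\<dots> \<le> (\<integral>\<^sup>+ s. 4 * (?D s * indicator ?I s + ?D (h - s) * indicator ?I s) \<partial>lborel)"
    using diff_energy_triangle[OF assms(1) per p, of h]
    by (intro nn_integral_mono) (auto simp: indicator_def)
  also have "\<dots> = 8 * (\<integral>\<^sup>+ s\<in>?I. ?D s \<partial>lborel)"
    by (simp add: nn_integral_cmult nn_integral_add refl) (simp flip: mult_2 mult.assoc)
  finally have 1: "ennreal (h / 3) * ?D h \<le> 8 * (\<integral>\<^sup>+ s\<in>?I. ?D s \<partial>lborel)" .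
  have "ennreal (1 / h) * ?D h = ennreal (3 / h\<^sup>2) * (ennreal (h / 3) * ?D h)"
    using h by (simp add: power2_eq_square flip: mult.assoc ennreal_mult')
  also have "\<dots> \<le> ennreal (3 / h\<^sup>2) * (8 * (\<integral>\<^sup>+ s\<in>?I. ?D s \<partial>lborel))"
    by (intro mult_left_mono 1) auto
  also have "\<dots> = (\<integral>\<^sup>+ s\<in>?I. ennreal (24 / h\<^sup>2) * ?D s \<partial>lborel)"
    by (simp add: nn_integral_cmult mult.assoc)
       (simp flip: mult.assoc ennreal_mult' ennreal_numeral)
  also have "\<dots> \<le> (\<integral>\<^sup>+ s. 11 * (?D s * ennreal (1 / s\<^sup>2) * indicator ?I s) \<partial>lborel)"
  proof (rule nn_integral_mono)
    fix s
    have "ennreal (24 / h\<^sup>2) \<le> 11 * ennreal (1 / s\<^sup>2)" if "s \<in> ?I"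
    proof -
      have s: "0 < s" "s < 2 * h / 3" using that h by auto
      then have "s\<^sup>2 \<le> (2 * h / 3)\<^sup>2" by (intro power_mono) auto
      also have "(2 * h / 3)\<^sup>2 = 4 / 9 * h\<^sup>2" by (simp add: power2_eq_square)
      finally have "24 * s\<^sup>2 \<le> 11 * h\<^sup>2" using zero_le_power2[of h] by linarith
      then have "24 / h\<^sup>2 \<le> 11 * (1 / s\<^sup>2)" using s h by (simp add: field_simps)
      then show ?thesis by (simp add: ennreal_leI flip: ennreal_mult' ennreal_numeral)
    qed
    then show "ennreal (24 / h\<^sup>2) * ?D s * indicator ?I s
        \<le> 11 * (?D s * ennreal (1 / s\<^sup>2) * indicator ?I s)"
      using mult_right_mono[of "ennreal (24 / h\<^sup>2)" "11 * ennreal (1 / s\<^sup>2)" "?D s"]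
      by (auto simp: indicator_def ac_simps)
  qed
  also have "\<dots> = 11 * (\<integral>\<^sup>+ s\<in>?I. ?D s * ennreal (1 / s\<^sup>2) \<partial>lborel)"
    by (simp add: nn_integral_cmult)
  finally show ?thesis .
qed

section \<open>The degree of Lipschitz maps\<close>

text \<open>Averaging over the base point: every edge of the polygon contributes the same integral.\<close>

lemma nn_integral_polygon:
  fixes g :: "real \<Rightarrow> complex"
  assumes [measurable]: "g \<in> borel_measurable borel" and per: "\<And>t. g (t + 2 * pi) = g t"
    and h: "h = 2 * pi / 2 ^ k"
  shows "(\<integral>\<^sup>+ t\<in>{0..<2 * pi}. ennreal (\<Sum>i<2 ^ k. norm (g (t + 2 * pi * real (Suc i) / 2 ^ k)
             - g (t + 2 * pi * real i / 2 ^ k)) powr p) \<partial>lborel)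
         = ennreal (2 * pi) * (ennreal (1 / h) * diff_energy p g h)"
proof -
  have arg: "t + 2 * pi * real (Suc i) / 2 ^ k = t + h * real i + h"
     "t + 2 * pi * real i / 2 ^ k = t + h * real i" for t i
    unfolding h by (simp_all add: field_simps)
  have "(\<integral>\<^sup>+ t\<in>{0..<2 * pi}. ennreal (\<Sum>i<2 ^ k. norm (g (t + 2 * pi * real (Suc i) / 2 ^ k)
             - g (t + 2 * pi * real i / 2 ^ k)) powr p) \<partial>lborel)
      = (\<integral>\<^sup>+ t. (\<Sum>i<2 ^ k. ennreal (norm (g (t + h * real i + h) - g (t + h * real i)) powr p)
           * indicator {0..<2 * pi} t) \<partial>lborel)"
    unfolding arg(1) unfolding arg(2)
    by (intro nn_integral_cong, subst sum_ennreal[symmetric]) (auto simp only: powr_ge_zero sum_distrib_right)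
  also have "\<dots> = (\<Sum>i<(2::nat) ^ k. diff_energy p g h)"
    by (subst nn_integral_sum) (auto simp: diff_energy_shift[OF assms(1) per])
  also have "\<dots> = ennreal (2 ^ k) * diff_energy p g h"
    by (simp flip: ennreal_power)
  also have "ennreal (2 ^ k) = ennreal (2 * pi) * ennreal (1 / h)"
    by (simp add: h flip: ennreal_mult')
  finally show ?thesis by (simp add: mult.assoc)
qed

lemma sum_dyadic_scales_le:
  fixes w :: "real \<Rightarrow> ennreal"
  assumes [measurable]: "w \<in> borel_measurable borel"
  shows "(\<Sum>k\<in>{2..K}. \<integral>\<^sup>+ s\<in>{2 * pi / 2 ^ k / 3<..<2 * (2 * pi / 2 ^ k) / 3}. w s \<partial>lborel)
      \<le> (\<integral>\<^sup>+ s\<in>{- pi..<pi}. w s \<partial>lborel)"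
proof -
  define I where "I = (\<lambda>k::nat. {2 * pi / 2 ^ k / 3<..<2 * (2 * pi / 2 ^ k) / 3})"
  have disj: "I k \<inter> I l = {}" if "k < l" for k l
  proof -
    have "(2::real) ^ Suc k \<le> 2 ^ l" using that by (intro power_increasing) auto
    then have "2 * (2 * pi / 2 ^ l) \<le> 2 * pi / 2 ^ k" by (simp add: field_simps)
    then show ?thesis by (auto simp: I_def)
  qed
  then have "disjoint_family_on I {2..K}"
    unfolding disjoint_family_on_def by (metis Int_commute linorder_neqE_nat)
  then have ind: "(\<Sum>k\<in>{2..K}. indicator (I k) s) = (indicator (\<Union>k\<in>{2..K}. I k) s :: ennreal)" for s
    by (intro indicator_UN_disjoint[symmetric]) auto
  have sub: "(\<Union>k\<in>{2..K}. I k) \<subseteq> {- pi..<pi}"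
  proof safe
    fix k s assume "k \<in> {2..K}" "s \<in> I k"
    moreover have "2 * pi / 2 ^ k \<le> 2 * pi / 2 ^ 2" if "2 \<le> k"
      using that by (intro divide_left_mono power_increasing) auto
    ultimately have "s < 2 * (2 * pi / 2 ^ 2) / 3" by (fastforce simp: I_def)
    moreover have "0 < s" using \<open>s \<in> I k\<close> by (auto simp: I_def intro: less_trans[rotated])
    ultimately show "s \<in> {- pi..<pi}" using pi_gt_zero by auto
  qed
  have "(\<Sum>k\<in>{2..K}. \<integral>\<^sup>+ s\<in>I k. w s \<partial>lborel) = (\<integral>\<^sup>+ s. (\<Sum>k\<in>{2..K}. w s * indicator (I k) s) \<partial>lborel)"
    by (rule nn_integral_sum[symmetric]) (auto simp: I_def)
  also have "\<dots> = (\<integral>\<^sup>+ s\<in>(\<Union>k\<in>{2..K}. I k). w s \<partial>lborel)"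
    by (simp add: ind flip: sum_distrib_left)
  also have "\<dots> \<le> (\<integral>\<^sup>+ s\<in>{- pi..<pi}. w s \<partial>lborel)"
    using sub by (intro nn_integral_mono) (auto simp: indicator_def)
  finally show ?thesis unfolding I_def .
qed

text \<open>The estimate for Lipschitz maps: integrate the polygon inequality over the base point, sum the
  disjoint bands of scales and let the number of vertices tend to infinity.\<close>

lemma degree_le_diff_energy:
  fixes g :: "real \<Rightarrow> complex" and d :: int and L p :: real
  assumes unit: "\<And>x. norm (g x) = 1" and per: "\<And>x. g (x + 2 * pi) = g x"
    and lip: "\<And>x y. norm (g x - g y) \<le> L * \<bar>x - y\<bar>"
    and d: "\<And>t. winding_number (\<lambda>s. g (t + 2 * pi * s)) 0 = of_int d"
    and p: "1 < p" "p \<le> 2"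
  shows "ennreal \<bar>real_of_int d\<bar>
      \<le> ennreal (44 * (p - 1)) * (\<integral>\<^sup>+ s\<in>{- pi..<pi}. diff_energy p g s * ennreal (1 / s\<^sup>2) \<partial>lborel)"
proof -
  define W where "W = (\<integral>\<^sup>+ s\<in>{- pi..<pi}. diff_energy p g s * ennreal (1 / s\<^sup>2) \<partial>lborel)"
  define h where "h = (\<lambda>k::nat. 2 * pi / 2 ^ k)"
  define A where "A = (\<lambda>k t. \<Sum>i<2 ^ k. norm (g (t + 2 * pi * real (Suc i) / 2 ^ k)
             - g (t + 2 * pi * real i / 2 ^ k)) powr p)"
  have "0 \<le> norm (g 1 - g 0)" by (rule norm_ge_zero)
  also have "\<dots> \<le> L" using lip[of 1 0] by simp
  finally have L: "0 \<le> L" .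
  have "continuous_on UNIV g"
    by (rule lipschitz_on_continuous_on[of L], rule lipschitz_onI) (use lip L in \<open>auto simp: dist_norm\<close>)
  then have meas[measurable]: "g \<in> borel_measurable borel" by (rule borel_measurable_continuous_onI)
  have hpos: "0 < h k" for k by (simp add: h_def)
  have A_nonneg: "0 \<le> A k t" for k t unfolding A_def by (intro sum_nonneg) auto
  have A_meas[measurable]: "A k \<in> borel_measurable borel" for k unfolding A_def by measurable
  have intA: "(\<integral>\<^sup>+ t\<in>{0..<2 * pi}. ennreal (A k t) \<partial>lborel)
      = ennreal (2 * pi) * (ennreal (1 / h k) * diff_energy p g (h k))" for k
    unfolding A_def by (rule nn_integral_polygon[OF meas per]) (simp add: h_def)
  have A_sum: "(\<Sum>k\<in>{2..K}. \<integral>\<^sup>+ t\<in>{0..<2 * pi}. ennreal (A k t) \<partial>lborel) \<le> ennreal (22 * pi) * W" for K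
  proof -
    have "(\<Sum>k\<in>{2..K}. \<integral>\<^sup>+ t\<in>{0..<2 * pi}. ennreal (A k t) \<partial>lborel)
        \<le> (\<Sum>k\<in>{2..K}. ennreal (2 * pi) * (11 * (\<integral>\<^sup>+ s\<in>{h k / 3<..<2 * h k / 3}. diff_energy p g s * ennreal (1 / s\<^sup>2) \<partial>lborel)))"
      unfolding intA by (intro sum_mono mult_left_mono diff_energy_le_average meas per p hpos) auto
    also have "\<dots> = ennreal (22 * pi) * (\<Sum>k\<in>{2..K}. (\<integral>\<^sup>+ s\<in>{h k / 3<..<2 * h k / 3}. diff_energy p g s * ennreal (1 / s\<^sup>2) \<partial>lborel))"
      by (simp add: sum_distrib_left ennreal_mult' flip: mult.assoc) (simp add: ac_simps flip: mult.assoc ennreal_mult' ennreal_numeral)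
    also have "\<dots> \<le> ennreal (22 * pi) * W"
      unfolding W_def h_def by (intro mult_left_mono sum_dyadic_scales_le) auto
    finally show ?thesis .
  qed
  have A_bound: "A k t \<le> (2 * pi * L) powr p * (2 powr (1 - p)) ^ k" for k t
  proof -
    have "A k t \<le> (\<Sum>i<(2::nat) ^ k. (L * h k) powr p)"
      unfolding A_def
    proof (intro sum_mono powr_mono2)
      fix i
      have "t + 2 * pi * real (Suc i) / 2 ^ k - (t + 2 * pi * real i / 2 ^ k) = h k"
        by (simp add: h_def field_simps)
      then show "norm (g (t + 2 * pi * real (Suc i) / 2 ^ k) - g (t + 2 * pi * real i / 2 ^ k)) \<le> L * h k"
        using lip[of "t + 2 * pi * real (Suc i) / 2 ^ k" "t + 2 * pi * real i / 2 ^ k"] hpos[of k] by simp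
    qed (use p in auto)
    also have "\<dots> = 2 ^ k * ((2 * pi * L) / 2 ^ k) powr p" by (simp add: h_def mult.commute)
    also have "\<dots> = (2 * pi * L) powr p * (2 ^ k / (2 ^ k) powr p)"
      using L by (simp add: powr_divide)
    also have "(2::real) ^ k / (2 ^ k) powr p = (2 ^ k) powr (1 - p)"
      by (simp add: powr_diff)
    also have "\<dots> = (2 powr (1 - p)) ^ k"
      by (simp add: powr_powr mult.commute flip: powr_realpow)
    finally show ?thesis .
  qed
  \<comment> \<open>Bound for the boundary term; it tends to \<open>0\<close> because \<open>2 powr (1 - p) < 1\<close>.\<close>
  define \<epsilon> where "\<epsilon> = (\<lambda>k. 60 * pi * ((2 * pi * L) powr p * (2 powr (1 - p)) ^ k))"
  have "2 powr (1 - p) < (1::real)" using p by (simp add: powr_less_one)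
  then have \<epsilon>: "\<epsilon> \<longlonglongrightarrow> 0" unfolding \<epsilon>_def by (intro tendsto_mult_right_zero LIMSEQ_power_zero) auto
  have main: "ennreal (4 * pi\<^sup>2 * \<bar>real_of_int d\<bar>) \<le> ennreal (\<epsilon> K) + ennreal (24 * (p - 1)) * (ennreal (22 * pi) * W)"
    if K: "1 \<le> K" "L * h K < 2" for K
  proof -
    have swap: "(\<integral>\<^sup>+ t. (\<Sum>k\<in>{2..K}. ennreal (A k t) * indicator {0..<2 * pi} t) \<partial>lborel)
        = (\<Sum>k\<in>{2..K}. \<integral>\<^sup>+ t\<in>{0..<2 * pi}. ennreal (A k t) \<partial>lborel)"
      by (rule nn_integral_sum) auto
    have pt: "2 * pi * \<bar>real_of_int d\<bar> \<le> 30 * A K t + 24 * (p - 1) * (\<Sum>k\<in>{2..K}. A k t)" for t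
      using winding_number_le_polygon[OF unit per lip d p, of K t] K unfolding A_def h_def by simp
    have "ennreal (4 * pi\<^sup>2 * \<bar>real_of_int d\<bar>) = (\<integral>\<^sup>+ t\<in>{0..<2 * pi}. ennreal (2 * pi * \<bar>real_of_int d\<bar>) \<partial>lborel)"
      by (simp add: nn_integral_cmult power2_eq_square flip: ennreal_mult'')
    also have "\<dots> \<le> (\<integral>\<^sup>+ t. ennreal (30 * ((2 * pi * L) powr p * (2 powr (1 - p)) ^ K)) * indicator {0..<2 * pi} t
         + ennreal (24 * (p - 1)) * (\<Sum>k\<in>{2..K}. ennreal (A k t) * indicator {0..<2 * pi} t) \<partial>lborel)"
    proof (rule nn_integral_mono)
      fix t
      have "ennreal (2 * pi * \<bar>real_of_int d\<bar>)
          \<le> ennreal (30 * ((2 * pi * L) powr p * (2 powr (1 - p)) ^ K) + 24 * (p - 1) * (\<Sum>k\<in>{2..K}. A k t))"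
        using pt[of t] A_bound[of K t] by (intro ennreal_leI) linarith
      also have "\<dots> = ennreal (30 * ((2 * pi * L) powr p * (2 powr (1 - p)) ^ K))
          + ennreal (24 * (p - 1)) * (\<Sum>k\<in>{2..K}. ennreal (A k t))"
        using p A_nonneg by (simp add: ennreal_plus sum_nonneg ennreal_mult')
      finally show "ennreal (2 * pi * \<bar>real_of_int d\<bar>) * indicator {0..<2 * pi} t
          \<le> ennreal (30 * ((2 * pi * L) powr p * (2 powr (1 - p)) ^ K)) * indicator {0..<2 * pi} t
         + ennreal (24 * (p - 1)) * (\<Sum>k\<in>{2..K}. ennreal (A k t) * indicator {0..<2 * pi} t)"
        by (auto simp: indicator_def)
    qed
    also have "\<dots> = ennreal (\<epsilon> K)
        + ennreal (24 * (p - 1)) * (\<integral>\<^sup>+ t. (\<Sum>k\<in>{2..K}. ennreal (A k t) * indicator {0..<2 * pi} t) \<partial>lborel)"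
      by (subst nn_integral_add, simp, simp, subst nn_integral_cmult, simp)
        (simp add: nn_integral_cmult \<epsilon>_def mult.commute flip: ennreal_mult'')
    also have "\<dots> \<le> ennreal (\<epsilon> K) + ennreal (24 * (p - 1)) * (ennreal (22 * pi) * W)"
      unfolding swap by (intro add_left_mono mult_left_mono A_sum) auto
    finally show ?thesis .
  qed
  have "(\<lambda>k. ennreal (\<epsilon> k) + ennreal (24 * (p - 1)) * (ennreal (22 * pi) * W))
      \<longlonglongrightarrow> ennreal 0 + ennreal (24 * (p - 1)) * (ennreal (22 * pi) * W)"
    by (intro tendsto_add tendsto_ennrealI \<epsilon> tendsto_const)
  moreover have "\<forall>\<^sub>F K in sequentially. ennreal (4 * pi\<^sup>2 * \<bar>real_of_int d\<bar>)
      \<le> ennreal (\<epsilon> K) + ennreal (24 * (p - 1)) * (ennreal (22 * pi) * W)"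
  proof -
    have "(\<lambda>k. L * (2 * pi * (1 / 2) ^ k)) \<longlonglongrightarrow> 0"
      by (intro tendsto_mult_right_zero LIMSEQ_power_zero) auto
    moreover have "L * (2 * pi * (1 / 2) ^ k) = L * h k" for k
      by (simp add: h_def power_one_over)
    ultimately have "\<forall>\<^sub>F K in sequentially. L * h K < 2"
      by (intro order_tendstoD[of _ 0]) auto
    with eventually_ge_at_top[of 1] show ?thesis
      by eventually_elim (rule main)
  qed
  ultimately have "ennreal (4 * pi\<^sup>2 * \<bar>real_of_int d\<bar>) \<le> ennreal 0 + ennreal (24 * (p - 1)) * (ennreal (22 * pi) * W)"
    by (rule tendsto_lowerbound) auto
  then have "ennreal (1 / (4 * pi\<^sup>2)) * ennreal (4 * pi\<^sup>2 * \<bar>real_of_int d\<bar>)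
      \<le> ennreal (1 / (4 * pi\<^sup>2)) * (ennreal (24 * (p - 1)) * (ennreal (22 * pi) * W))"
    by (intro mult_left_mono) auto
  also have "ennreal (1 / (4 * pi\<^sup>2)) * ennreal (4 * pi\<^sup>2 * \<bar>real_of_int d\<bar>) = ennreal \<bar>real_of_int d\<bar>"
    by (simp flip: ennreal_mult')
  also have "ennreal (1 / (4 * pi\<^sup>2)) * (ennreal (24 * (p - 1)) * (ennreal (22 * pi) * W))
      = ennreal (1 / (4 * pi\<^sup>2) * (24 * (p - 1) * (22 * pi))) * W"
  proof -
    have "ennreal (1 / (4 * pi\<^sup>2) * (24 * (p - 1) * (22 * pi)))
        = ennreal (1 / (4 * pi\<^sup>2)) * (ennreal (24 * (p - 1)) * ennreal (22 * pi))"
      using p by (subst ennreal_mult[of "1 / (4 * pi\<^sup>2)"], simp, simp, subst ennreal_mult[of "24 * (p - 1)"])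
        auto
    then show ?thesis by (simp only: mult.assoc)
  qed
  also have "1 / (4 * pi\<^sup>2) * (24 * (p - 1) * (22 * pi)) = 132 / pi * (p - 1)"
    by (simp add: power2_eq_square field_simps)
  also have "ennreal (132 / pi * (p - 1)) * W \<le> ennreal (44 * (p - 1)) * W"
    using p pi_gt3 by (intro mult_right_mono ennreal_leI) (auto simp: field_simps)
  finally show ?thesis unfolding W_def .
qed

section \<open>Means of unit-valued maps\<close>

text \<open>The graph of \<open>x powr p\<close> lies above its tangent at \<open>y\<close>, in a form without subtraction; this is Young's
  inequality for the conjugate exponents \<open>p\<close> and \<open>p / (p - 1)\<close>.\<close>

lemma powr_above_tangent:
  fixes x y p :: real
  assumes "0 \<le> x" "0 \<le> y" "1 < p"
  shows "p * (x * y powr (p - 1)) \<le> x powr p + (p - 1) * y powr p"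
proof -
  define q where "q = p / (p - 1)"
  have q: "1 < q" "1 / p + 1 / q = 1" "(p - 1) * q = p" "p / q = p - 1"
    using assms by (auto simp: q_def field_simps)
  have "x * y powr (p - 1) \<le> x powr p / p + (y powr (p - 1)) powr q / q"
    by (rule Youngs_inequality) (use assms q in auto)
  then have "p * (x * y powr (p - 1)) \<le> p * (x powr p / p + y powr p / q)"
    using assms by (intro mult_left_mono) (auto simp: powr_powr q)
  also have "\<dots> = x powr p + p / q * y powr p" using assms by (simp add: distrib_left)
  finally show ?thesis by (simp add: q)
qed

text \<open>Jensen's inequality for the \<open>p\<close>-th power of the norm: integrate the tangent bound at the mean of the
  norm, so that the linear terms cancel.\<close>

lemma (in finite_measure) norm_average_powr_le:
  fixes X :: "'a \<Rightarrow> complex"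
  assumes [measurable]: "X \<in> borel_measurable M" and bound: "\<And>x. x \<in> space M \<Longrightarrow> norm (X x) \<le> B"
    and p: "1 < p" and pos: "0 < measure M (space M)"
  shows "ennreal (norm (integral\<^sup>L M X /\<^sub>R measure M (space M)) powr p)
      \<le> ennreal (1 / measure M (space M)) * (\<integral>\<^sup>+ x. ennreal (norm (X x) powr p) \<partial>M)"
proof -
  define \<mu> where "\<mu> = measure M (space M)"
  define y where "y = (LINT x|M. norm (X x)) / \<mu>"
  have \<mu>: "0 < \<mu>" using pos by (simp add: \<mu>_def)
  have y: "0 \<le> y" unfolding y_def using \<mu> by (intro divide_nonneg_pos Bochner_Integration.integral_nonneg) auto
  have int1: "integrable M (\<lambda>x. norm (X x))"
    by (rule integrable_const_bound[of _ B]) (auto intro!: AE_I2 bound)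
  have int2: "integrable M (\<lambda>x. norm (X x) powr p)"
    by (rule integrable_const_bound[of _ "B powr p"]) (use p in \<open>auto intro!: AE_I2 powr_mono2 bound\<close>)
  have "norm (integral\<^sup>L M X /\<^sub>R \<mu>) \<le> y"
    using integral_norm_bound[of M X] \<mu> by (simp add: y_def divide_inverse mult.commute)
  then have "norm (integral\<^sup>L M X /\<^sub>R \<mu>) powr p \<le> y powr p" using p by (intro powr_mono2) auto
  also have "\<dots> = (p * (y * y powr (p - 1)) - (p - 1) * y powr p)"
    using y by (cases "y = 0") (auto simp: powr_diff algebra_simps)
  also have "\<dots> = (1 / \<mu>) * (LINT x|M. p * (norm (X x) * y powr (p - 1)) - (p - 1) * y powr p)"
    using \<mu> int1 by (simp add: y_def \<mu>_def field_simps)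
  also have "\<dots> \<le> (1 / \<mu>) * (LINT x|M. norm (X x) powr p)"
  proof (intro mult_left_mono integral_mono)
    fix x
    show "p * (norm (X x) * y powr (p - 1)) - (p - 1) * y powr p \<le> norm (X x) powr p"
      using powr_above_tangent[of "norm (X x)" y p] y p by simp
  qed (use \<mu> int1 int2 in auto)
  finally have "ennreal (norm (integral\<^sup>L M X /\<^sub>R \<mu>) powr p) \<le> ennreal ((1 / \<mu>) * (LINT x|M. norm (X x) powr p))"
    by (rule ennreal_leI)
  also have "\<dots> = ennreal (1 / \<mu>) * ennreal (LINT x|M. norm (X x) powr p)"
    by (rule ennreal_mult') (use \<mu> in simp)
  also have "ennreal (LINT x|M. norm (X x) powr p) = (\<integral>\<^sup>+ x. ennreal (norm (X x) powr p) \<partial>M)"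
    by (rule nn_integral_eq_integral[OF int2, symmetric]) auto
  finally show ?thesis unfolding \<mu>_def .
qed

text \<open>The variance identity: for a unit-valued map the mean square distance of two independent values
  measures how far the mean is from the unit circle.\<close>

lemma (in finite_measure) nn_integral_norm_diff_square:
  fixes X :: "'a \<Rightarrow> complex"
  assumes [measurable]: "X \<in> borel_measurable M" and unit: "\<And>x. norm (X x) = 1"
  shows "(\<integral>\<^sup>+ x. \<integral>\<^sup>+ y. ennreal ((norm (X x - X y))\<^sup>2) \<partial>M \<partial>M)
      = ennreal (2 * ((measure M (space M))\<^sup>2 - (norm (integral\<^sup>L M X))\<^sup>2))"
proof -
  define \<mu> where "\<mu> = measure M (space M)"
  define I where "I = integral\<^sup>L M X"
  have int: "integrable M X" by (rule integrable_const_bound[of _ 1]) (auto simp: unit)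
  have sq: "(norm (X x - X y))\<^sup>2 = 2 - 2 * (X x \<bullet> X y)" for x y
    using dot_norm_neg[of "X x" "X y"] by (simp add: unit)
  have inner_le: "X x \<bullet> X y \<le> 1" for x y
    using norm_cauchy_schwarz[of "X x" "X y"] by (simp add: unit)
  have innerI_le: "X x \<bullet> I \<le> \<mu>" for x
  proof -
    have "X x \<bullet> I = (LINT y|M. X x \<bullet> X y)" unfolding I_def using int by simp
    also have "\<dots> \<le> (LINT y|M. 1)" using int inner_le by (intro integral_mono) auto
    finally show ?thesis by (simp add: \<mu>_def)
  qed
  have "(\<integral>\<^sup>+ y. ennreal ((norm (X x - X y))\<^sup>2) \<partial>M) = ennreal (2 * \<mu> - 2 * (X x \<bullet> I))" for x
  proof -
    have "(\<integral>\<^sup>+ y. ennreal ((norm (X x - X y))\<^sup>2) \<partial>M) = ennreal (LINT y|M. 2 - 2 * (X x \<bullet> X y))"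
      unfolding sq using int inner_le by (intro nn_integral_eq_integral) auto
    also have "(LINT y|M. 2 - 2 * (X x \<bullet> X y)) = 2 * \<mu> - 2 * (X x \<bullet> I)"
      using int by (simp add: \<mu>_def I_def)
    finally show ?thesis .
  qed
  then have "(\<integral>\<^sup>+ x. \<integral>\<^sup>+ y. ennreal ((norm (X x - X y))\<^sup>2) \<partial>M \<partial>M) = (\<integral>\<^sup>+ x. ennreal (2 * \<mu> - 2 * (X x \<bullet> I)) \<partial>M)"
    by simp
  also have "\<dots> = ennreal (LINT x|M. 2 * \<mu> - 2 * (X x \<bullet> I))"
    using int innerI_le by (intro nn_integral_eq_integral) auto
  also have "(LINT x|M. 2 * \<mu> - 2 * (X x \<bullet> I)) = 2 * \<mu> * \<mu> - 2 * (I \<bullet> I)"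
    using int by (simp add: \<mu>_def I_def)
  also have "\<dots> = 2 * (\<mu>\<^sup>2 - (norm I)\<^sup>2)" by (simp add: dot_square_norm power2_eq_square algebra_simps)
  finally show ?thesis unfolding \<mu>_def I_def .
qed

lemma nn_integral_set_swap:
  fixes G :: "real \<Rightarrow> real \<Rightarrow> ennreal"
  assumes G[measurable]: "case_prod G \<in> borel_measurable (borel \<Otimes>\<^sub>M borel)"
    and [measurable]: "A \<in> sets borel" "B \<in> sets borel"
  shows "(\<integral>\<^sup>+ t\<in>A. (\<integral>\<^sup>+ r\<in>B. G t r \<partial>lborel) \<partial>lborel)
       = (\<integral>\<^sup>+ r\<in>B. (\<integral>\<^sup>+ t\<in>A. G t r \<partial>lborel) \<partial>lborel)"
proof -
  have "(\<integral>\<^sup>+ t\<in>A. (\<integral>\<^sup>+ r\<in>B. G t r \<partial>lborel) \<partial>lborel)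
      = (\<integral>\<^sup>+ t. (\<integral>\<^sup>+ r. G t r * indicator B r * indicator A t \<partial>lborel) \<partial>lborel)"
    by (intro nn_integral_cong nn_integral_multc[symmetric]) measurable
  also have "\<dots> = (\<integral>\<^sup>+ r. (\<integral>\<^sup>+ t. G t r * indicator B r * indicator A t \<partial>lborel) \<partial>lborel)"
    by (rule lborel_pair.Fubini') measurable
  also have "\<dots> = (\<integral>\<^sup>+ r. (\<integral>\<^sup>+ t. G t r * indicator A t * indicator B r \<partial>lborel) \<partial>lborel)"
    by (intro nn_integral_cong) (simp only: mult.assoc mult.commute[of "indicator B _ :: ennreal"])
  also have "\<dots> = (\<integral>\<^sup>+ r\<in>B. (\<integral>\<^sup>+ t\<in>A. G t r \<partial>lborel) \<partial>lborel)"
    by (intro nn_integral_cong nn_integral_multc) measurable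
  finally show ?thesis .
qed

section \<open>Window averages of periodic unit-valued maps\<close>

definition window_average :: "(real \<Rightarrow> complex) \<Rightarrow> real \<Rightarrow> real \<Rightarrow> complex" where
  "window_average F \<epsilon> t = (LINT s:{t - \<epsilon>..t + \<epsilon>}|lborel. F s) /\<^sub>R (2 * \<epsilon>)"

locale unit_periodic =
  fixes F :: "real \<Rightarrow> complex"
  assumes meas [measurable]: "F \<in> borel_measurable borel"
    and per: "F (t + 2 * pi) = F t"
    and unit: "norm (F t) = 1"
begin

abbreviation u :: "real \<Rightarrow> real \<Rightarrow> complex" where "u \<equiv> window_average F"

lemma set_integrable: "set_integrable lborel {a..b} F"
  unfolding set_integrable_def
  by (rule integrableI_bounded_set[of "{a..b}" _ _ 1]) (auto simp: unit indicator_def emeasure_lborel_Icc_eq)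

lemma set_integral_dist_le:
  assumes "a \<le> b" "a' \<le> b'"
  shows "norm ((LINT s:{a..b}|lborel. F s) - (LINT s:{a'..b'}|lborel. F s)) \<le> \<bar>a - a'\<bar> + \<bar>b - b'\<bar>"
proof -
  let ?J = "\<lambda>x y::real. {min x y..max x y}"
  have "norm ((LINT s:{a..b}|lborel. F s) - (LINT s:{a'..b'}|lborel. F s))
      = norm (LINT s|lborel. indicator {a..b} s *\<^sub>R F s - indicator {a'..b'} s *\<^sub>R F s)"
    using set_integrable unfolding set_lebesgue_integral_def set_integrable_def
    by (subst Bochner_Integration.integral_diff) auto
  also have "\<dots> \<le> (LINT s|lborel. indicator (?J a a') s + indicator (?J b b') s)"
  proof (rule Bochner_Integration.integral_norm_bound_integral)
    fix s
    show "norm (indicator {a..b} s *\<^sub>R F s - indicator {a'..b'} s *\<^sub>R F s)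
        \<le> indicator (?J a a') s + indicator (?J b b') s"
      using assms by (auto simp: indicator_def unit)
  qed (use set_integrable in \<open>auto simp: set_integrable_def\<close>)
  also have "\<dots> = (max a a' - min a a') + (max b b' - min b b')" by simp
  also have "\<dots> = \<bar>a - a'\<bar> + \<bar>b - b'\<bar>" by (simp add: max_def min_def)
  finally show ?thesis .
qed

lemma continuous_on_average:
  "continuous_on ({0<..} \<times> UNIV) (\<lambda>(\<epsilon>, t). u \<epsilon> t)"
proof -
  define I where "I = (\<lambda>(\<epsilon>, t). LINT s:{t - \<epsilon>..t + \<epsilon>}|lborel. F s)"
  have "4-lipschitz_on ({0<..} \<times> UNIV) I"
  proof (rule lipschitz_onI)
    fix x y :: "real \<times> real" assume xy: "x \<in> {0<..} \<times> UNIV" "y \<in> {0<..} \<times> UNIV"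
    have "dist (I x) (I y) \<le> \<bar>(snd x - fst x) - (snd y - fst y)\<bar> + \<bar>(snd x + fst x) - (snd y + fst y)\<bar>"
      unfolding I_def dist_norm case_prod_beta by (rule set_integral_dist_le) (use xy in auto)
    also have "\<dots> \<le> 2 * \<bar>fst x - fst y\<bar> + 2 * \<bar>snd x - snd y\<bar>"
    proof -
      have e: "(snd x - fst x) - (snd y - fst y) = (snd x - snd y) - (fst x - fst y)"
        "(snd x + fst x) - (snd y + fst y) = (snd x - snd y) + (fst x - fst y)" by simp_all
      show ?thesis unfolding e
        using abs_triangle_ineq4[of "snd x - snd y" "fst x - fst y"]
          abs_triangle_ineq[of "snd x - snd y" "fst x - fst y"] by linarith
    qed
    also have "\<dots> \<le> 2 * dist x y + 2 * dist x y"
      using dist_fst_le[of x y] dist_snd_le[of x y] by (simp add: dist_real_def)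
    finally show "dist (I x) (I y) \<le> 4 * dist x y" by simp
  qed simp
  then have "continuous_on ({0<..} \<times> UNIV) I" by (rule lipschitz_on_continuous_on)
  then have "continuous_on ({0<..} \<times> UNIV) (\<lambda>x. I x /\<^sub>R (2 * fst x))"
    by (intro continuous_intros) auto
  then show ?thesis by (simp add: I_def window_average_def case_prod_beta)
qed

lemma average_lipschitz:
  assumes "0 < \<epsilon>"
  shows "norm (u \<epsilon> x - u \<epsilon> y) \<le> 1 / \<epsilon> * \<bar>x - y\<bar>"
proof -
  have "u \<epsilon> x - u \<epsilon> y = ((LINT s:{x - \<epsilon>..x + \<epsilon>}|lborel. F s) - (LINT s:{y - \<epsilon>..y + \<epsilon>}|lborel. F s)) /\<^sub>R (2 * \<epsilon>)"
    by (simp only: window_average_def scaleR_diff_right)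
  moreover have "norm (z /\<^sub>R (2 * \<epsilon>)) = norm z / (2 * \<epsilon>)" for z :: complex
    using assms by (simp add: field_simps)
  ultimately have "norm (u \<epsilon> x - u \<epsilon> y) = norm ((LINT s:{x - \<epsilon>..x + \<epsilon>}|lborel. F s) - (LINT s:{y - \<epsilon>..y + \<epsilon>}|lborel. F s)) / (2 * \<epsilon>)"
    by simp
  also have "\<dots> \<le> (\<bar>x - y\<bar> + \<bar>x - y\<bar>) / (2 * \<epsilon>)"
    using set_integral_dist_le[of "x - \<epsilon>" "x + \<epsilon>" "y - \<epsilon>" "y + \<epsilon>"] assms
    by (intro divide_right_mono) auto
  finally show ?thesis by simp
qed

lemma average_centered: "u \<epsilon> t = (LINT s:{- \<epsilon>..\<epsilon>}|lborel. F (t + s)) /\<^sub>R (2 * \<epsilon>)"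
proof -
  have "(LINT s:{t - \<epsilon>..t + \<epsilon>}|lborel. F s) = (LINT s:{- \<epsilon>..\<epsilon>}|lborel. F (t + s))"
    unfolding set_lebesgue_integral_def
    by (subst lborel_integral_real_affine[of 1 _ t]) (auto intro!: Bochner_Integration.integral_cong simp: indicator_def)
  then show ?thesis by (simp add: window_average_def)
qed

lemma average_periodic: "u \<epsilon> (t + 2 * pi) = u \<epsilon> t"
proof -
  have "F (t + 2 * pi + s) = F (t + s)" for s using per[of "t + s"] by (simp add: algebra_simps)
  then show ?thesis by (simp add: average_centered)
qed

lemma average_measurable [measurable]: "u \<epsilon> \<in> borel_measurable borel"
proof -
  have "(\<lambda>t. LINT s|lborel. indicator {- \<epsilon>..\<epsilon>} s *\<^sub>R F (t + s)) \<in> borel_measurable borel"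
    by measurable
  then show ?thesis unfolding average_centered set_lebesgue_integral_def by measurable
qed

text \<open>An average of translates of \<open>F\<close> has no more difference energy than \<open>F\<close>, by convexity and
  translation invariance.\<close>

lemma diff_energy_average_le:
  assumes \<epsilon>: "0 < \<epsilon>" and p: "1 < p"
  shows "diff_energy p (u \<epsilon>) s \<le> diff_energy p F s"
proof -
  define M where "M = restrict_space lborel {- \<epsilon>..\<epsilon>}"
  have M: "measure M (space M) = 2 * \<epsilon>" "emeasure M (space M) = ennreal (2 * \<epsilon>)"
    using \<epsilon> by (auto simp: M_def space_restrict_space measure_restrict_space emeasure_restrict_space)
  interpret finite_measure M by standard (simp add: M)
  have measM: "g \<in> borel_measurable borel \<Longrightarrow> g \<in> borel_measurable M" for g :: "real \<Rightarrow> 'b::topological_space"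
    unfolding M_def by (intro measurable_restrict_space1) simp
  define H where "H = (\<lambda>t. ennreal (norm (F (t + s) - F t) powr p))"
  have H[measurable]: "H \<in> borel_measurable borel" unfolding H_def by measurable
  have ac: "t + s + r = t + r + s" for t r :: real by simp
  have pt: "ennreal (norm (u \<epsilon> (t + s) - u \<epsilon> t) powr p) \<le> ennreal (1 / (2 * \<epsilon>)) * (\<integral>\<^sup>+ r\<in>{- \<epsilon>..\<epsilon>}. H (t + r) \<partial>lborel)" for t
  proof -
    have "set_integrable lborel {- \<epsilon>..\<epsilon>} (\<lambda>r. F (t + r))" for t
      unfolding set_integrable_def
      by (rule integrableI_bounded_set[of "{- \<epsilon>..\<epsilon>}" _ _ 1]) (auto simp: unit indicator_def emeasure_lborel_Icc_eq)
    then have "u \<epsilon> (t + s) - u \<epsilon> t = (LINT r:{- \<epsilon>..\<epsilon>}|lborel. F (t + s + r) - F (t + r)) /\<^sub>R (2 * \<epsilon>)"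
      by (simp add: average_centered set_integral_diff flip: scaleR_diff_right)
    also have "\<dots> = integral\<^sup>L M (\<lambda>r. F (t + s + r) - F (t + r)) /\<^sub>R measure M (space M)"
      unfolding M by (simp add: M_def integral_restrict_space set_lebesgue_integral_def)
    also have "ennreal (norm \<dots> powr p) \<le> ennreal (1 / measure M (space M)) * (\<integral>\<^sup>+ r. ennreal (norm (F (t + s + r) - F (t + r)) powr p) \<partial>M)"
    proof (rule norm_average_powr_le[where B = 2])
      show "(\<lambda>r. F (t + s + r) - F (t + r)) \<in> borel_measurable M" by (rule measM) measurable
      show "norm (F (t + s + r) - F (t + r)) \<le> 2" for r
        using norm_triangle_ineq4[of "F (t + s + r)" "F (t + r)"] by (simp add: unit)
    qed (use \<epsilon> p in \<open>auto simp: M\<close>)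
    also have "(\<integral>\<^sup>+ r. ennreal (norm (F (t + s + r) - F (t + r)) powr p) \<partial>M) = (\<integral>\<^sup>+ r\<in>{- \<epsilon>..\<epsilon>}. H (t + r) \<partial>lborel)"
      unfolding M_def H_def by (subst nn_integral_restrict_space) (auto simp: ac)
    finally show ?thesis by (simp add: M)
  qed
  have "diff_energy p (u \<epsilon>) s \<le> (\<integral>\<^sup>+ t. (ennreal (1 / (2 * \<epsilon>)) * (\<integral>\<^sup>+ r\<in>{- \<epsilon>..\<epsilon>}. H (t + r) \<partial>lborel)) * indicator {0..<2 * pi} t \<partial>lborel)"
    unfolding diff_energy_def by (intro nn_integral_mono mult_right_mono pt) auto
  also have "\<dots> = ennreal (1 / (2 * \<epsilon>)) * (\<integral>\<^sup>+ t\<in>{0..<2 * pi}. (\<integral>\<^sup>+ r\<in>{- \<epsilon>..\<epsilon>}. H (t + r) \<partial>lborel) \<partial>lborel)"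
    unfolding mult.assoc by (rule nn_integral_cmult) measurable
  also have "(\<integral>\<^sup>+ t\<in>{0..<2 * pi}. (\<integral>\<^sup>+ r\<in>{- \<epsilon>..\<epsilon>}. H (t + r) \<partial>lborel) \<partial>lborel)
      = (\<integral>\<^sup>+ r\<in>{- \<epsilon>..\<epsilon>}. (\<integral>\<^sup>+ t\<in>{0..<2 * pi}. H (t + r) \<partial>lborel) \<partial>lborel)"
    by (rule nn_integral_set_swap) measurable
  also have "\<dots> = (\<integral>\<^sup>+ r\<in>{- \<epsilon>..\<epsilon>}. diff_energy p F s \<partial>lborel)"
    by (simp only: H_def diff_energy_shift[OF meas per])
  also have "\<dots> = diff_energy p F s * ennreal (2 * \<epsilon>)"
    using \<epsilon> by (simp add: nn_integral_cmult)
  also have "ennreal (1 / (2 * \<epsilon>)) * (diff_energy p F s * ennreal (2 * \<epsilon>)) = diff_energy p F s * (ennreal (1 / (2 * \<epsilon>)) * ennreal (2 * \<epsilon>))"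
    by (simp add: ac_simps)
  also have "ennreal (1 / (2 * \<epsilon>)) * ennreal (2 * \<epsilon>) = 1"
    using \<epsilon> by (simp flip: ennreal_mult')
  finally show ?thesis by simp
qed

end

text \<open>The measure with density \<open>w\<close> is finite on intervals shrinking to the null set \<open>{0}\<close>, so it is
  continuous from above along them.\<close>

lemma small_near_zero:
  fixes w :: "real \<Rightarrow> ennreal"
  assumes [measurable]: "w \<in> borel_measurable borel"
    and fin: "(\<integral>\<^sup>+ s\<in>{- pi..<pi}. w s \<partial>lborel) < \<infinity>" and c: "0 < c"
  obtains r where "0 < r" "r < pi" "(\<integral>\<^sup>+ s\<in>{- r..r}. w s \<partial>lborel) < c"
proof -
  define N where "N = density lborel w"
  define J where "J = (\<lambda>n::nat. {- (1 / real (Suc n))..1 / real (Suc n)})"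
  have emN: "emeasure N A = (\<integral>\<^sup>+ s\<in>A. w s \<partial>lborel)" if "A \<in> sets borel" for A
    unfolding N_def using that by (intro emeasure_density) auto
  have Jpi: "J n \<subseteq> {- pi..<pi}" for n
  proof -
    have n: "1 / real (Suc n) \<le> 1" by simp
    show ?thesis
    proof
      fix x assume "x \<in> J n"
      then have "- (1 / real (Suc n)) \<le> x \<and> x \<le> 1 / real (Suc n)" by (simp add: J_def)
      then have "- pi \<le> x \<and> x < pi" using n pi_gt3 by linarith
      then show "x \<in> {- pi..<pi}" by simp
    qed
  qed
  have "emeasure N (J n) \<le> emeasure N {- pi..<pi}" for n
    using Jpi by (intro emeasure_mono) (auto simp: N_def)
  moreover have "emeasure N {- pi..<pi} < \<infinity>" using fin by (simp add: emN)
  ultimately have "emeasure N (J n) \<noteq> \<infinity>" for n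
    by (metis leD)
  moreover have "decseq J"
    unfolding J_def by (intro antimonoI) (auto simp: frac_le intro: order_trans[rotated] order_trans)
  ultimately have "(\<lambda>n. emeasure N (J n)) \<longlonglongrightarrow> emeasure N (\<Inter>n. J n)"
    by (intro Lim_emeasure_decseq) (auto simp: N_def J_def)
  also have "(\<Inter>n. J n) = {0}"
  proof -
    have "x = 0" if x: "\<And>n. x \<in> J n" for x
    proof (rule ccontr)
      assume "x \<noteq> 0"
      then obtain n where "inverse (real (Suc n)) < \<bar>x\<bar>" using reals_Archimedean[of "\<bar>x\<bar>"] by auto
      then show False using x[of n] by (auto simp: J_def inverse_eq_divide abs_if split: if_splits)
    qed
    then show ?thesis by (auto simp: J_def)
  qed
  also have "emeasure N {0} = 0"
    by (simp add: emN nn_integral_indicator_singleton)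
  finally have "\<forall>\<^sub>F n in sequentially. emeasure N (J n) < c" using c by (rule order_tendstoD)
  then obtain n where "emeasure N (J n) < c" by (auto simp: eventually_sequentially)
  then have small: "(\<integral>\<^sup>+ s\<in>{- (1 / real (Suc n))..1 / real (Suc n)}. w s \<partial>lborel) < c"
    by (simp only: emN J_def) (simp add: emN)
  have "1 / real (Suc n) \<le> 1" by simp
  then have "1 / real (Suc n) < pi" using pi_gt3 by linarith
  then show ?thesis using small by (intro that[of "1 / real (Suc n)"]) auto
qed

text \<open>One homotopy moves the radius from \<open>a\<close> to \<open>b\<close> and the base point from \<open>x\<close> to \<open>y\<close> along segments.\<close>

lemma winding_number_deformation:
  fixes v :: "real \<times> real \<Rightarrow> complex"
  assumes cont: "continuous_on ({0<..e} \<times> UNIV) v"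
    and nz: "\<And>\<epsilon> t. 0 < \<epsilon> \<Longrightarrow> \<epsilon> \<le> e \<Longrightarrow> v (\<epsilon>, t) \<noteq> 0"
    and per: "\<And>\<epsilon> t. v (\<epsilon>, t + 2 * pi) = v (\<epsilon>, t)"
    and ab: "0 < a" "a \<le> e" "0 < b" "b \<le> e"
  shows "winding_number (\<lambda>s. v (a, x + 2 * pi * s)) 0 = winding_number (\<lambda>s. v (b, y + 2 * pi * s)) 0"
proof (rule winding_number_homotopic_loops)
  define \<epsilon> where "\<epsilon> = (\<lambda>r. (1 - r) * a + r * b)"
  define h where "h = (\<lambda>(r, s). v (\<epsilon> r, (1 - r) * x + r * y + 2 * pi * s))"
  have \<epsilon>: "0 < \<epsilon> r \<and> \<epsilon> r \<le> e" if "0 \<le> r" "r \<le> 1" for r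
  proof
    show "0 < \<epsilon> r" unfolding \<epsilon>_def using that ab
      by (cases "r = 0") (auto intro!: add_nonneg_pos)
    have "\<epsilon> r \<le> (1 - r) * e + r * e"
      unfolding \<epsilon>_def using that ab by (intro add_mono mult_left_mono) auto
    then show "\<epsilon> r \<le> e" by (simp add: algebra_simps)
  qed
  have "continuous_on ({0..1} \<times> {0..1}) h"
    unfolding h_def case_prod_beta
    by (rule continuous_on_compose2[OF cont]) (use \<epsilon> in \<open>auto simp: \<epsilon>_def intro!: continuous_intros\<close>)
  moreover have "h \<in> ({0..1} \<times> {0..1}) \<rightarrow> - {0}" using \<epsilon> nz by (auto simp: h_def)
  moreover have "pathfinish (h \<circ> Pair r) = pathstart (h \<circ> Pair r)" for r
    using per[of "\<epsilon> r" "(1 - r) * x + r * y"] by (simp add: h_def pathfinish_def pathstart_def)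
  ultimately show "homotopic_loops (- {0}) (\<lambda>s. v (a, x + 2 * pi * s)) (\<lambda>s. v (b, y + 2 * pi * s))"
    unfolding homotopic_loops by (intro exI[of _ h]) (auto simp: h_def \<epsilon>_def)
qed

lemma norm_sgn_diff_le:
  fixes a b :: complex
  assumes "1 / 2 \<le> norm a" "1 / 2 \<le> norm b"
  shows "norm (sgn a - sgn b) \<le> 4 * norm (a - b)"
proof -
  have a: "norm a > 0" and b: "norm b > 0" using assms by auto
  have "norm a *\<^sub>R (sgn a - sgn b) = (a - b) - (norm a - norm b) *\<^sub>R sgn b"
    using a b by (simp add: sgn_div_norm algebra_simps)
  then have "norm a * norm (sgn a - sgn b) = norm ((a - b) - (norm a - norm b) *\<^sub>R sgn b)"
    by (metis abs_norm_cancel norm_scaleR)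
  also have "\<dots> \<le> norm (a - b) + norm ((norm a - norm b) *\<^sub>R sgn b)" by (rule norm_triangle_ineq4)
  also have "\<dots> \<le> 2 * norm (a - b)"
    using norm_triangle_ineq3[of a b] b by (simp add: norm_sgn)
  finally have "norm a * norm (sgn a - sgn b) \<le> 2 * norm (a - b)" .
  moreover have "1 / 2 * norm (sgn a - sgn b) \<le> norm a * norm (sgn a - sgn b)"
    using assms by (intro mult_right_mono) auto
  ultimately show ?thesis by simp
qed

context unit_periodic
begin

text \<open>By the variance identity \<open>8 \<epsilon>^2 (1 - |u|^2)\<close> is the double integral of \<open>|F(x) - F(y)|^2\<close> over a
  window of length \<open>2 \<epsilon>\<close>.  As \<open>p \<le> 2\<close> and chords are at most \<open>2\<close>, the square is at most twice the
  \<open>p\<close>-th power; with \<open>y = x + s\<close> one has \<open>|s| \<le> 2 \<epsilon>\<close>, so the weight \<open>1 / s^2\<close> absorbs \<open>\<epsilon>^2\<close>.\<close>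

lemma one_minus_norm_average_le:
  assumes \<epsilon>: "0 < \<epsilon>" "\<epsilon> < pi" and p: "1 < p" "p \<le> 2"
  shows "ennreal (1 - (norm (u \<epsilon> t))\<^sup>2)
    \<le> (\<integral>\<^sup>+ s\<in>{- (2 * \<epsilon>)..2 * \<epsilon>}. diff_energy p F s * ennreal (1 / s\<^sup>2) \<partial>lborel)"
proof -
  let ?J = "{t - \<epsilon>..t + \<epsilon>}" and ?S = "{- (2 * \<epsilon>)..2 * \<epsilon>}"
  define W where "W = (\<integral>\<^sup>+ s\<in>?S. diff_energy p F s * ennreal (1 / s\<^sup>2) \<partial>lborel)"
  define G where "G = (\<lambda>x s. ennreal (norm (F (x + s) - F x) powr p))"
  have G[measurable]: "case_prod G \<in> borel_measurable (borel \<Otimes>\<^sub>M borel)" unfolding G_def by measurable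
  define M where "M = restrict_space lborel ?J"
  have M: "measure M (space M) = 2 * \<epsilon>" "emeasure M (space M) = ennreal (2 * \<epsilon>)"
    using \<epsilon> by (auto simp: M_def space_restrict_space measure_restrict_space emeasure_restrict_space)
  interpret finite_measure M by standard (simp add: M)
  have FM: "F \<in> borel_measurable M" unfolding M_def by (intro measurable_restrict_space1) simp
  have nnM: "integral\<^sup>N M g = (\<integral>\<^sup>+ x\<in>?J. g x \<partial>lborel)" for g
    unfolding M_def by (rule nn_integral_restrict_space) simp
  have I: "integral\<^sup>L M F = (2 * \<epsilon>) *\<^sub>R u \<epsilon> t"
    using \<epsilon> unfolding M_def window_average_def set_lebesgue_integral_def
    by (subst integral_restrict_space) auto
  have "ennreal (8 * \<epsilon>\<^sup>2 * (1 - (norm (u \<epsilon> t))\<^sup>2)) = ennreal (2 * ((2 * \<epsilon>)\<^sup>2 - (norm (integral\<^sup>L M F))\<^sup>2))"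
    using \<epsilon> by (simp add: I power_mult_distrib algebra_simps)
  also have "\<dots> = (\<integral>\<^sup>+ x. \<integral>\<^sup>+ y. ennreal ((norm (F x - F y))\<^sup>2) \<partial>M \<partial>M)"
    using nn_integral_norm_diff_square[OF FM unit] by (simp add: M)
  also have "\<dots> = (\<integral>\<^sup>+ x\<in>?J. (\<integral>\<^sup>+ y\<in>?J. ennreal ((norm (F x - F y))\<^sup>2) \<partial>lborel) \<partial>lborel)"
    by (simp add: nnM)
  also have "\<dots> \<le> (\<integral>\<^sup>+ x\<in>?J. (\<integral>\<^sup>+ s\<in>?S. 2 * G x s \<partial>lborel) \<partial>lborel)"
  proof (intro nn_integral_mono)
    fix x
    have "(\<integral>\<^sup>+ y\<in>?J. ennreal ((norm (F x - F y))\<^sup>2) \<partial>lborel) \<le> (\<integral>\<^sup>+ s\<in>?S. 2 * G x s \<partial>lborel)" if x: "x \<in> ?J"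
    proof -
      have "(\<integral>\<^sup>+ y\<in>?J. ennreal ((norm (F x - F y))\<^sup>2) \<partial>lborel)
          = (\<integral>\<^sup>+ s. ennreal ((norm (F x - F (x + s)))\<^sup>2) * indicator ?J (x + s) \<partial>lborel)"
        by (subst nn_integral_real_affine[of _ 1 x]) auto
      also have "\<dots> \<le> (\<integral>\<^sup>+ s\<in>?S. 2 * G x s \<partial>lborel)"
      proof (intro nn_integral_mono mult_mono)
        fix s
        define \<delta> where "\<delta> = norm (F (x + s) - F x)"
        have \<delta>: "0 \<le> \<delta>" "\<delta> \<le> 2"
          using norm_triangle_ineq4[of "F (x + s)" "F x"] by (auto simp: \<delta>_def unit)
        have "\<delta>\<^sup>2 \<le> 2 * \<delta> powr p"
        proof (cases "\<delta> = 0")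
          case False
          then have "\<delta>\<^sup>2 = \<delta> powr p * \<delta> powr (2 - p)" using \<delta> by (simp flip: powr_add)
          also have "\<dots> \<le> \<delta> powr p * 2"
          proof (intro mult_left_mono)
            have "\<delta> powr (2 - p) \<le> 2 powr (2 - p)" using \<delta> p by (intro powr_mono2) auto
            also have "\<dots> \<le> 2 powr 1" using p by (intro powr_mono) auto
            finally show "\<delta> powr (2 - p) \<le> 2" by simp
          qed auto
          finally show ?thesis by (simp add: mult.commute)
        qed simp
        then have "ennreal (\<delta>\<^sup>2) \<le> ennreal (2 * \<delta> powr p)" by (rule ennreal_leI)
        then show "ennreal ((norm (F x - F (x + s)))\<^sup>2) \<le> 2 * G x s"
          by (simp add: G_def \<delta>_def ennreal_mult' norm_minus_commute)
        show "indicator ?J (x + s) \<le> (indicator ?S s :: ennreal)"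
          using x by (auto simp: indicator_def)
      qed auto
      finally show ?thesis .
    qed
    then show "(\<integral>\<^sup>+ y\<in>?J. ennreal ((norm (F x - F y))\<^sup>2) \<partial>lborel) * indicator ?J x
        \<le> (\<integral>\<^sup>+ s\<in>?S. 2 * G x s \<partial>lborel) * indicator ?J x"
      by (auto simp: indicator_def)
  qed
  also have "\<dots> = (\<integral>\<^sup>+ s\<in>?S. (\<integral>\<^sup>+ x\<in>?J. 2 * G x s \<partial>lborel) \<partial>lborel)"
    by (rule nn_integral_set_swap) auto
  also have "\<dots> \<le> (\<integral>\<^sup>+ s. ennreal (8 * \<epsilon>\<^sup>2) * (diff_energy p F s * ennreal (1 / s\<^sup>2) * indicator ?S s) \<partial>lborel)"
  proof (intro nn_integral_mono)
    fix s
    have "(\<integral>\<^sup>+ x\<in>?J. 2 * G x s \<partial>lborel) \<le> (\<integral>\<^sup>+ x\<in>{t - \<epsilon>..<t - \<epsilon> + 2 * pi}. 2 * G x s \<partial>lborel)"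
      using \<epsilon> by (intro nn_integral_mono) (auto simp: indicator_def)
    also have "\<dots> = (\<integral>\<^sup>+ x\<in>{0..<2 * pi}. 2 * G x s \<partial>lborel)"
    proof (rule nn_integral_period)
      show "2 * G (x + 2 * pi) s = 2 * G x s" for x
        using per[of "x + s"] per[of x] by (simp add: G_def algebra_simps)
    qed measurable
    also have "\<dots> = 2 * diff_energy p F s"
      by (simp add: G_def diff_energy_def mult.assoc nn_integral_cmult)
    finally have 1: "(\<integral>\<^sup>+ x\<in>?J. 2 * G x s \<partial>lborel) \<le> 2 * diff_energy p F s" .
    show "(\<integral>\<^sup>+ x\<in>?J. 2 * G x s \<partial>lborel) * indicator ?S s
        \<le> ennreal (8 * \<epsilon>\<^sup>2) * (diff_energy p F s * ennreal (1 / s\<^sup>2) * indicator ?S s)"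
    proof (cases "s \<in> ?S \<and> s \<noteq> 0")
      case True
      have "\<bar>s\<bar>\<^sup>2 \<le> (2 * \<epsilon>)\<^sup>2" using True by (intro power_mono) auto
      then have "2 * s\<^sup>2 \<le> 8 * \<epsilon>\<^sup>2" by (simp add: power_mult_distrib)
      moreover have "0 < s\<^sup>2" using True by simp
      ultimately have "2 \<le> 8 * \<epsilon>\<^sup>2 * (1 / s\<^sup>2)" by (simp add: pos_le_divide_eq)
      then have "ennreal 2 \<le> ennreal (8 * \<epsilon>\<^sup>2 * (1 / s\<^sup>2))" by (rule ennreal_leI)
      then have "2 \<le> ennreal (8 * \<epsilon>\<^sup>2) * ennreal (1 / s\<^sup>2)" by (simp flip: ennreal_mult')
      then have "2 * diff_energy p F s \<le> (ennreal (8 * \<epsilon>\<^sup>2) * ennreal (1 / s\<^sup>2)) * diff_energy p F s"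
        by (intro mult_right_mono) auto
      with 1 have "(\<integral>\<^sup>+ x\<in>?J. 2 * G x s \<partial>lborel) \<le> (ennreal (8 * \<epsilon>\<^sup>2) * ennreal (1 / s\<^sup>2)) * diff_energy p F s"
        by (rule order.trans)
      then show ?thesis using True by (simp add: mult.assoc mult.commute[of "diff_energy p F s"])
    next
      case False
      then show ?thesis by (auto simp: G_def)
    qed
  qed
  also have "\<dots> = ennreal (8 * \<epsilon>\<^sup>2) * W"
    unfolding W_def by (rule nn_integral_cmult) measurable
  finally have "ennreal (1 / (8 * \<epsilon>\<^sup>2)) * ennreal (8 * \<epsilon>\<^sup>2 * (1 - (norm (u \<epsilon> t))\<^sup>2))
      \<le> ennreal (1 / (8 * \<epsilon>\<^sup>2)) * (ennreal (8 * \<epsilon>\<^sup>2) * W)"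
    by (intro mult_left_mono) auto
  also have "ennreal (1 / (8 * \<epsilon>\<^sup>2)) * ennreal (8 * \<epsilon>\<^sup>2 * (1 - (norm (u \<epsilon> t))\<^sup>2)) = ennreal (1 - (norm (u \<epsilon> t))\<^sup>2)"
    using \<epsilon> by (simp flip: ennreal_mult')
  also have "ennreal (1 / (8 * \<epsilon>\<^sup>2)) * (ennreal (8 * \<epsilon>\<^sup>2) * W) = W"
  proof -
    have "ennreal (1 / (8 * \<epsilon>\<^sup>2)) * ennreal (8 * \<epsilon>\<^sup>2) = 1" using \<epsilon> by (simp flip: ennreal_mult')
    then show ?thesis by (simp flip: mult.assoc)
  qed
  finally show ?thesis unfolding W_def .
qed

lemma average_away_from_zero:
  assumes p: "1 < p" "p \<le> 2"
    and fin: "(\<integral>\<^sup>+ s\<in>{- pi..<pi}. diff_energy p F s * ennreal (1 / s\<^sup>2) \<partial>lborel) < \<infinity>"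
  obtains e where "0 < e" "e < pi" "\<And>\<epsilon> t. 0 < \<epsilon> \<Longrightarrow> \<epsilon> \<le> e \<Longrightarrow> 1 / 2 \<le> norm (u \<epsilon> t)"
proof -
  obtain r where r: "0 < r" "r < pi"
    and small: "(\<integral>\<^sup>+ s\<in>{- r..r}. diff_energy p F s * ennreal (1 / s\<^sup>2) \<partial>lborel) < ennreal (3 / 4)"
    by (rule small_near_zero[OF _ fin, of "ennreal (3 / 4)"]) (auto simp: ennreal_zero_less_divide)
  show ?thesis
  proof (rule that[of "r / 2"])
    fix \<epsilon> t assume \<epsilon>: "0 < \<epsilon>" "\<epsilon> \<le> r / 2"
    have "ennreal (1 - (norm (u \<epsilon> t))\<^sup>2)
        \<le> (\<integral>\<^sup>+ s\<in>{- (2 * \<epsilon>)..2 * \<epsilon>}. diff_energy p F s * ennreal (1 / s\<^sup>2) \<partial>lborel)"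
      using \<epsilon> r p by (intro one_minus_norm_average_le) auto
    also have "\<dots> \<le> (\<integral>\<^sup>+ s\<in>{- r..r}. diff_energy p F s * ennreal (1 / s\<^sup>2) \<partial>lborel)"
      using \<epsilon> by (intro nn_integral_mono) (auto simp: indicator_def)
    finally have "ennreal (1 - (norm (u \<epsilon> t))\<^sup>2) < ennreal (3 / 4)"
      using small by (rule order.strict_trans1)
    then have "1 - (norm (u \<epsilon> t))\<^sup>2 < 3 / 4" 
      by (metis ennreal_leI not_less)
    then have "(1 / 2)\<^sup>2 \<le> (norm (u \<epsilon> t))\<^sup>2" by (simp add: power2_eq_square)
    then show "1 / 2 \<le> norm (u \<epsilon> t)" by (rule power2_le_imp_le) simp
  qed (use r in auto)
qed

text \<open>All normalised averages of small radius share one winding number.  It is estimated at the fixed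
  radius \<open>e\<close>, where the normalised average is Lipschitz; normalising is \<open>4\<close>-Lipschitz away from the
  disc of radius \<open>1/2\<close>, which costs the factor \<open>4 powr p \<le> 16\<close>, and \<open>44 * 16 = 704\<close>.\<close>

lemma degree_of_averages:
  assumes p: "1 < p" "p \<le> 2"
    and fin: "(\<integral>\<^sup>+ s\<in>{- pi..<pi}. diff_energy p F s * ennreal (1 / s\<^sup>2) \<partial>lborel) < \<infinity>"
  obtains e d where "0 < e" "e < pi"
    and "\<And>\<epsilon>. 0 < \<epsilon> \<Longrightarrow> \<epsilon> \<le> e \<Longrightarrow> winding_number (\<lambda>s. sgn (u \<epsilon> (2 * pi * s))) 0 = of_int d"
    and "ennreal \<bar>real_of_int d\<bar>
      \<le> ennreal (704 * (p - 1)) * (\<integral>\<^sup>+ s\<in>{- pi..<pi}. diff_energy p F s * ennreal (1 / s\<^sup>2) \<partial>lborel)"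
proof -
  obtain e where e: "0 < e" "e < pi" and ge: "\<And>\<epsilon> t. 0 < \<epsilon> \<Longrightarrow> \<epsilon> \<le> e \<Longrightarrow> 1 / 2 \<le> norm (u \<epsilon> t)"
    using average_away_from_zero[OF p fin] by blast
  define v where "v = (\<lambda>(\<epsilon>, t). sgn (u \<epsilon> t))"
  have nz: "u \<epsilon> t \<noteq> 0" if "0 < \<epsilon>" "\<epsilon> \<le> e" for \<epsilon> t
    using ge[OF that, of t] by auto
  have cont: "continuous_on ({0<..e} \<times> UNIV) v"
  proof -
    have "continuous_on ({0<..e} \<times> UNIV) (\<lambda>x. sgn ((\<lambda>(\<epsilon>, t). u \<epsilon> t) x))"
      by (intro continuous_on_sgn continuous_on_subset[OF continuous_on_average]) (use nz in auto)
    then show ?thesis by (simp add: v_def case_prod_beta)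
  qed
  have deform: "winding_number (\<lambda>s. v (a, x + 2 * pi * s)) 0 = winding_number (\<lambda>s. v (b, y + 2 * pi * s)) 0"
    if "0 < a" "a \<le> e" "0 < b" "b \<le> e" for a b x y
    by (rule winding_number_deformation[OF cont]) (use that nz in \<open>auto simp: v_def average_periodic sgn_zero_iff\<close>)
  define g where "g = (\<lambda>t. v (e, t))"
  have g: "g t = sgn (u e t)" for t by (simp add: g_def v_def)
  have gunit: "norm (g t) = 1" for t using nz[of e t] e by (simp add: g norm_sgn)
  have gper: "g (t + 2 * pi) = g t" for t by (simp add: g average_periodic)
  have gdiff: "norm (g x - g y) \<le> 4 * norm (u e x - u e y)" for x y
    unfolding g using e by (intro norm_sgn_diff_le ge) auto
  have glip: "norm (g x - g y) \<le> 4 / e * \<bar>x - y\<bar>" for x y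
    using order.trans[OF gdiff[of x y] mult_left_mono[OF average_lipschitz[of e x y], of 4]] e by simp
  have contg: "continuous_on X g" for X
    by (rule lipschitz_on_continuous_on[of "4 / e"], rule lipschitz_onI) (use glip e in \<open>auto simp: dist_norm\<close>)
  have "winding_number (\<lambda>s. g (2 * pi * s)) 0 \<in> \<int>"
  proof (rule integer_winding_number)
    show "path (\<lambda>s. g (2 * pi * s))"
      unfolding path_def by (rule continuous_on_compose2[OF contg[of UNIV]]) (auto intro!: continuous_intros)
    show "pathfinish (\<lambda>s. g (2 * pi * s)) = pathstart (\<lambda>s. g (2 * pi * s))"
      using gper[of 0] by (simp add: pathfinish_def pathstart_def)
    show "0 \<notin> path_image (\<lambda>s. g (2 * pi * s))"
    proof
      assume "0 \<in> path_image (\<lambda>s. g (2 * pi * s))"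
      then obtain s where "g (2 * pi * s) = 0" by (auto simp: path_image_def)
      then show False using gunit[of "2 * pi * s"] by simp
    qed
  qed
  then obtain d where d: "winding_number (\<lambda>s. g (2 * pi * s)) 0 = of_int d"
    by (elim Ints_cases)
  show ?thesis
  proof (rule that[of e d])
    show "winding_number (\<lambda>s. sgn (u \<epsilon> (2 * pi * s))) 0 = of_int d" if "0 < \<epsilon>" "\<epsilon> \<le> e" for \<epsilon>
      using deform[of \<epsilon> e 0 0] that e d by (simp add: g_def v_def)
    have "winding_number (\<lambda>s. g (t + 2 * pi * s)) 0 = of_int d" for t
      using deform[of e e t 0] e d by (simp add: g_def)
    then have "ennreal \<bar>real_of_int d\<bar>
        \<le> ennreal (44 * (p - 1)) * (\<integral>\<^sup>+ s\<in>{- pi..<pi}. diff_energy p g s * ennreal (1 / s\<^sup>2) \<partial>lborel)"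
      by (intro degree_le_diff_energy[OF gunit gper glip _ p])
    also have "\<dots> \<le> ennreal (44 * (p - 1)) * (\<integral>\<^sup>+ s. 16 * (diff_energy p F s * ennreal (1 / s\<^sup>2) * indicator {- pi..<pi} s) \<partial>lborel)"
    proof (intro mult_left_mono nn_integral_mono)
      fix s
      have "diff_energy p g s \<le> (\<integral>\<^sup>+ t. 16 * (ennreal (norm (u e (t + s) - u e t) powr p) * indicator {0..<2 * pi} t) \<partial>lborel)"
        unfolding diff_energy_def
      proof (rule nn_integral_mono)
        fix t
        define \<delta> where "\<delta> = norm (u e (t + s) - u e t)"
        have "norm (g (t + s) - g t) powr p \<le> (4 * \<delta>) powr p"
          using gdiff[of "t + s" t] p by (intro powr_mono2) (auto simp: \<delta>_def)
        also have "\<dots> = 4 powr p * \<delta> powr p" by (simp add: powr_mult \<delta>_def)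
        also have "\<dots> \<le> 16 * \<delta> powr p"
        proof (intro mult_right_mono)
          have "4 powr p \<le> 4 powr (2::real)" using p by (intro powr_mono) auto
          then show "4 powr p \<le> 16" by simp
        qed simp
        finally have "ennreal (norm (g (t + s) - g t) powr p) \<le> ennreal (16 * \<delta> powr p)" by (rule ennreal_leI)
        then show "ennreal (norm (g (t + s) - g t) powr p) * indicator {0..<2 * pi} t
            \<le> 16 * (ennreal (norm (u e (t + s) - u e t) powr p) * indicator {0..<2 * pi} t)"
          by (simp add: \<delta>_def ennreal_mult' indicator_def)
      qed
      also have "\<dots> = 16 * diff_energy p (u e) s"
        unfolding diff_energy_def by (rule nn_integral_cmult) measurable
      also have "\<dots> \<le> 16 * diff_energy p F s"
        using e p by (intro mult_left_mono diff_energy_average_le) auto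
      finally have "diff_energy p g s * ennreal (1 / s\<^sup>2) * indicator {- pi..<pi} s
          \<le> 16 * diff_energy p F s * ennreal (1 / s\<^sup>2) * indicator {- pi..<pi} s"
        by (intro mult_right_mono) auto
      then show "diff_energy p g s * ennreal (1 / s\<^sup>2) * indicator {- pi..<pi} s
          \<le> 16 * (diff_energy p F s * ennreal (1 / s\<^sup>2) * indicator {- pi..<pi} s)"
        by (simp only: mult.assoc)
    qed auto
    also have "\<dots> = ennreal (44 * (p - 1)) * (16 * (\<integral>\<^sup>+ s\<in>{- pi..<pi}. diff_energy p F s * ennreal (1 / s\<^sup>2) \<partial>lborel))"
      by (subst nn_integral_cmult) measurable
    also have "\<dots> = ennreal (704 * (p - 1)) * (\<integral>\<^sup>+ s\<in>{- pi..<pi}. diff_energy p F s * ennreal (1 / s\<^sup>2) \<partial>lborel)"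
    proof -
      have "ennreal (704 * (p - 1)) = ennreal (44 * (p - 1)) * ennreal 16"
        using p by (subst ennreal_mult[symmetric]) auto
      then show ?thesis by (simp add: mult.assoc)
    qed
    finally show "ennreal \<bar>real_of_int d\<bar>
      \<le> ennreal (704 * (p - 1)) * (\<integral>\<^sup>+ s\<in>{- pi..<pi}. diff_energy p F s * ennreal (1 / s\<^sup>2) \<partial>lborel)" .
  qed (use e in auto)
qed

end

section \<open>From the circle to the line\<close>

text \<open>Any interval of length \<open>2 pi\<close> parametrises the circle measure before completion; the freedom in the
  choice of \<open>a\<close> allows windows and differences to be centred at a given point.\<close>

definition arc_length :: "real \<Rightarrow> complex measure" where
  "arc_length a = distr (restrict_space lborel {a..<a + 2 * pi}) (restrict_space borel (sphere 0 1)) cis"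

lemma borel_measurable_cis [measurable]: "cis \<in> borel_measurable borel"
  by (intro borel_measurable_continuous_onI continuous_intros)

lemma cis_measurable_circle [measurable]:
  "cis \<in> measurable (restrict_space lborel {a..<b}) (restrict_space borel (sphere 0 1))"
  by (intro measurable_restrict_space2 measurable_restrict_space1) auto

lemma nn_integral_arc_length:
  assumes "h \<in> borel_measurable (restrict_space borel (sphere 0 1))"
  shows "(\<integral>\<^sup>+ y. h y \<partial>arc_length a) = (\<integral>\<^sup>+ t\<in>{a..<a + 2 * pi}. h (cis t) \<partial>lborel)"
  unfolding arc_length_def using assms
  by (subst nn_integral_distr) (auto simp: nn_integral_restrict_space)

lemma arc_length_eq: "arc_length a = arc_length b"
proof (rule measure_eqI)
  fix A assume "A \<in> sets (arc_length a)"
  then have A: "A \<in> sets (restrict_space borel (sphere 0 1))" by (simp add: arc_length_def)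
  then have Ab[measurable]: "A \<in> sets borel"
    by (auto simp: sets_restrict_space borel_closed intro: sets.Int)
  have "emeasure (arc_length c) A = (\<integral>\<^sup>+ t\<in>{0..<2 * pi}. indicator A (cis t) \<partial>lborel)" for c
  proof -
    have "emeasure (arc_length c) A = (\<integral>\<^sup>+ y. indicator A y \<partial>arc_length c)"
      using A by (simp add: arc_length_def)
    also have "\<dots> = (\<integral>\<^sup>+ t\<in>{c..<c + 2 * pi}. indicator A (cis t) \<partial>lborel)"
      using A by (intro nn_integral_arc_length) auto
    also have "\<dots> = (\<integral>\<^sup>+ t\<in>{0..<2 * pi}. indicator A (cis t) \<partial>lborel)"
    proof (rule nn_integral_period)
      show "indicator A (cis (t + 2 * pi)) = indicator A (cis t)" for t by (simp flip: cis_mult)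
    qed measurable
    finally show ?thesis .
  qed
  then show "emeasure (arc_length a) A = emeasure (arc_length b) A" by simp
qed (simp add: arc_length_def)

lemma circle_measure_eq: "circle_measure = completion (arc_length a)"
  using arc_length_eq[of a 0] by (simp add: circle_measure_def arc_length_def)

lemma nn_integral_circle:
  assumes "h \<in> borel_measurable borel"
  shows "(\<integral>\<^sup>+ y. h y \<partial>circle_measure) = (\<integral>\<^sup>+ t\<in>{a..<a + 2 * pi}. h (cis t) \<partial>lborel)"
  unfolding circle_measure_eq[of a] nn_integral_completion
  using assms by (intro nn_integral_arc_length measurable_restrict_space1)

text \<open>Completion measurable maps agree almost everywhere with Borel maps; changing the Borel map where it
  leaves the unit circle makes it unit-valued everywhere, including off the circle.\<close>

lemma borel_unit_representative:
  fixes f :: "complex \<Rightarrow> complex"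
  assumes f: "f \<in> measurable circle_measure (restrict_space borel (sphere 0 1))"
  obtains g where "g \<in> borel_measurable borel" "\<And>x. norm (g x) = 1" "AE x in circle_measure. f x = g x"
proof -
  have f': "f \<in> borel_measurable (completion (arc_length 0))"
    using f unfolding circle_measure_eq[of 0] by (simp add: measurable_restrict_space2_iff)
  have ext: "\<exists>k \<in> borel_measurable borel. AE x in circle_measure. h x = k x"
    if h: "h \<in> borel_measurable (completion (arc_length 0))" for h :: "complex \<Rightarrow> real"
  proof -
    obtain k where k: "k \<in> borel_measurable (arc_length 0)" and ae: "AE x in arc_length 0. h x = k x"
      using completion_ex_borel_measurable_real[OF h] by blast
    define k' where "k' = (\<lambda>x. if x \<in> sphere 0 1 then k x else 0)"
    have "k \<in> borel_measurable (restrict_space borel (sphere 0 1))" using k by (simp add: arc_length_def)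
    then have "k' \<in> borel_measurable borel"
      unfolding k'_def by (subst (asm) measurable_restrict_space_iff) auto
    moreover have "AE x in arc_length 0. h x = k' x"
    proof -
      have "AE x in arc_length 0. x \<in> sphere 0 1"
        by (rule AE_I2) (simp add: arc_length_def space_restrict_space)
      with ae show ?thesis by eventually_elim (simp add: k'_def)
    qed
    ultimately show ?thesis unfolding circle_measure_eq[of 0] using AE_completion by blast
  qed
  obtain a where a[measurable]: "a \<in> borel_measurable borel" and a': "AE x in circle_measure. Re (f x) = a x"
    using ext[of "\<lambda>x. Re (f x)"] f' by auto
  obtain b where b[measurable]: "b \<in> borel_measurable borel" and b': "AE x in circle_measure. Im (f x) = b x"
    using ext[of "\<lambda>x. Im (f x)"] f' by auto
  define z where "z = (\<lambda>x. of_real (a x) + \<i> * of_real (b x))"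
  have [measurable]: "z \<in> borel_measurable borel" unfolding z_def by measurable
  define g where "g = (\<lambda>x. if norm (z x) = 1 then z x else 1)"
  have "AE x in circle_measure. norm (f x) = 1"
  proof (rule AE_I2)
    fix x assume "x \<in> space circle_measure"
    then have "f x \<in> space (restrict_space borel (sphere 0 1))" using f by (rule measurable_space[rotated])
    then show "norm (f x) = 1" by (simp add: space_restrict_space)
  qed
  with a' b' have "AE x in circle_measure. f x = g x"
  proof eventually_elim
    case (elim x)
    then have "f x = z x" by (simp add: z_def complex_eq_iff)
    then show ?case using elim by (simp add: g_def)
  qed
  moreover have "g \<in> borel_measurable borel" unfolding g_def by measurable
  ultimately show ?thesis using that[of g] by (simp add: g_def)
qed

lemma norm_cis_diff_le: "norm (cis x - cis (x + s)) \<le> \<bar>s\<bar>"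
proof -
  have "cis x - cis (x + s) = - cis x * (cis s - 1)" by (simp add: algebra_simps cis_mult)
  then have "norm (cis x - cis (x + s)) = norm (cis s - 1)" by (simp add: norm_mult)
  also have "\<dots> = 2 * \<bar>sin (s / 2)\<bar>" using dist_exp_i_1[of s] by (simp add: cis_conv_exp)
  also have "\<dots> \<le> 2 * \<bar>s / 2\<bar>" using abs_sin_x_le_abs_x[of "s / 2"] by linarith
  finally show ?thesis by simp
qed

lemma sobolev_energy_cong_AE:
  assumes "AE x in circle_measure. f x = g x"
  shows "sobolev_energy p f = sobolev_energy p g"
  unfolding sobolev_energy_def
proof (rule nn_integral_cong_AE)
  show "AE x in circle_measure. (\<integral>\<^sup>+ y. ennreal (norm (f x - f y) powr p / norm (x - y) ^ 2) \<partial>circle_measure)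
      = (\<integral>\<^sup>+ y. ennreal (norm (g x - g y) powr p / norm (x - y) ^ 2) \<partial>circle_measure)"
    using assms
  proof eventually_elim
    case (elim x)
    show ?case by (rule nn_integral_cong_AE) (use assms elim in \<open>auto elim!: eventually_mono\<close>)
  qed
qed

text \<open>Parametrise the inner integral by the angle \<open>s\<close> relative to the outer variable; the chord between
  \<open>cis x\<close> and \<open>cis (x + s)\<close> is at most \<open>|s|\<close>.\<close>

lemma diff_energy_le_sobolev_energy:
  assumes [measurable]: "f \<in> borel_measurable borel" and p: "1 < p"
  shows "(\<integral>\<^sup>+ s\<in>{- pi..<pi}. diff_energy p (f \<circ> cis) s * ennreal (1 / s\<^sup>2) \<partial>lborel) \<le> sobolev_energy p f"
proof -
  define k where "k = (\<lambda>x y. ennreal (norm (f x - f y) powr p / norm (x - y) ^ 2))"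
  have k[measurable]: "case_prod k \<in> borel_measurable (borel \<Otimes>\<^sub>M borel)"
    unfolding k_def by measurable
  define G where "G = (\<lambda>x s. ennreal (norm (f (cis (x + s)) - f (cis x)) powr p))"
  have G[measurable]: "case_prod G \<in> borel_measurable (borel \<Otimes>\<^sub>M borel)"
    unfolding G_def by measurable
  have "(\<integral>\<^sup>+ s\<in>{- pi..<pi}. diff_energy p (f \<circ> cis) s * ennreal (1 / s\<^sup>2) \<partial>lborel)
      = (\<integral>\<^sup>+ s\<in>{- pi..<pi}. (\<integral>\<^sup>+ x\<in>{0..<2 * pi}. G x s * ennreal (1 / s\<^sup>2) \<partial>lborel) \<partial>lborel)"
  proof (intro nn_integral_cong)
    fix s
    have "(\<integral>\<^sup>+ x\<in>{0..<2 * pi}. G x s * ennreal (1 / s\<^sup>2) \<partial>lborel)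
        = (\<integral>\<^sup>+ x. G x s * indicator {0..<2 * pi} x * ennreal (1 / s\<^sup>2) \<partial>lborel)"
      by (intro nn_integral_cong) (simp only: mult.assoc mult.commute[of "ennreal (1 / s\<^sup>2)"])
    also have "\<dots> = diff_energy p (f \<circ> cis) s * ennreal (1 / s\<^sup>2)"
      unfolding diff_energy_def by (subst nn_integral_multc) (auto simp: G_def)
    finally show "diff_energy p (f \<circ> cis) s * ennreal (1 / s\<^sup>2) * indicator {- pi..<pi} s
        = (\<integral>\<^sup>+ x\<in>{0..<2 * pi}. G x s * ennreal (1 / s\<^sup>2) \<partial>lborel) * indicator {- pi..<pi} s"
      by simp
  qed
  also have "\<dots> = (\<integral>\<^sup>+ x\<in>{0..<2 * pi}. (\<integral>\<^sup>+ s\<in>{- pi..<pi}. G x s * ennreal (1 / s\<^sup>2) \<partial>lborel) \<partial>lborel)"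
    by (rule nn_integral_set_swap[symmetric]) measurable
  also have "\<dots> \<le> (\<integral>\<^sup>+ x\<in>{0..<2 * pi}. (\<integral>\<^sup>+ s\<in>{- pi..<pi}. k (cis x) (cis (s + x)) \<partial>lborel) \<partial>lborel)"
  proof (intro nn_integral_mono mult_right_mono)
    fix x s
    show "G x s * ennreal (1 / s\<^sup>2) \<le> k (cis x) (cis (s + x))"
    \<comment> \<open>On the diagonal the kernel is a division by \<open>0\<close>, but there the increment of \<open>f\<close> vanishes.\<close>
    proof (cases "cis x = cis (x + s)")
      case True
      then show ?thesis using p by (simp add: G_def)
    next
      case False
      then have pos: "0 < norm (cis x - cis (x + s))" by simp
      then have le: "(norm (cis x - cis (x + s)))\<^sup>2 \<le> s\<^sup>2"
        using norm_cis_diff_le[of x s] power_mono[of "norm (cis x - cis (x + s))" "\<bar>s\<bar>" 2] by simp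
      have "norm (f (cis (x + s)) - f (cis x)) powr p * (1 / s\<^sup>2)
          \<le> norm (f (cis x) - f (cis (x + s))) powr p / (norm (cis x - cis (x + s)))\<^sup>2"
        using pos le order.strict_trans2[OF zero_less_power[OF pos] le]
        by (auto simp: norm_minus_commute intro!: divide_left_mono mult_pos_pos)
      then have "ennreal (norm (f (cis (x + s)) - f (cis x)) powr p * (1 / s\<^sup>2))
          \<le> ennreal (norm (f (cis x) - f (cis (x + s))) powr p / (norm (cis x - cis (x + s)))\<^sup>2)"
        by (rule ennreal_leI)
      then show ?thesis by (simp only: G_def k_def ennreal_mult' powr_ge_zero add.commute[of s x])
    qed
  qed auto
  also have "\<dots> = (\<integral>\<^sup>+ x\<in>{0..<2 * pi}. (\<integral>\<^sup>+ y. k (cis x) y \<partial>circle_measure) \<partial>lborel)"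
  proof (intro nn_integral_cong)
    fix x
    have "(\<integral>\<^sup>+ y. k (cis x) y \<partial>circle_measure) = (\<integral>\<^sup>+ t\<in>{x - pi..<x - pi + 2 * pi}. k (cis x) (cis t) \<partial>lborel)"
      by (rule nn_integral_circle) measurable
    also have "\<dots> = (\<integral>\<^sup>+ t\<in>{- pi + x..<pi + x}. k (cis x) (cis t) \<partial>lborel)" by (simp add: algebra_simps)
    also have "\<dots> = (\<integral>\<^sup>+ s\<in>{- pi..<pi}. k (cis x) (cis (s + x)) \<partial>lborel)"
      by (rule nn_integral_shift) measurable
    finally show "(\<integral>\<^sup>+ s\<in>{- pi..<pi}. k (cis x) (cis (s + x)) \<partial>lborel) * indicator {0..<2 * pi} x
        = (\<integral>\<^sup>+ y. k (cis x) y \<partial>circle_measure) * indicator {0..<2 * pi} x" by simp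
  qed
  also have "\<dots> = (\<integral>\<^sup>+ x. (\<integral>\<^sup>+ y. k x y \<partial>circle_measure) \<partial>circle_measure)"
  proof -
    have "(\<integral>\<^sup>+ y. k x y \<partial>circle_measure) = (\<integral>\<^sup>+ t\<in>{0..<0 + 2 * pi}. k x (cis t) \<partial>lborel)" for x
      by (rule nn_integral_circle) measurable
    moreover have "(\<lambda>x. \<integral>\<^sup>+ t\<in>{0..<0 + 2 * pi}. k x (cis t) \<partial>lborel) \<in> borel_measurable borel"
      by measurable
    ultimately have "(\<lambda>x. \<integral>\<^sup>+ y. k x y \<partial>circle_measure) \<in> borel_measurable borel" by simp
    from nn_integral_circle[OF this, of 0] show ?thesis by simp
  qed
  finally show ?thesis unfolding sobolev_energy_def k_def .
qed

lemma cis_mem_circle_arc_iff: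
  assumes "0 < \<epsilon>" "\<epsilon> < pi" "t - pi \<le> s" "s < t + pi"
  shows "cis s \<in> circle_arc (cis t) \<epsilon> \<longleftrightarrow> s \<in> {t - \<epsilon>..t + \<epsilon>}"
proof
  assume "cis s \<in> circle_arc (cis t) \<epsilon>"
  then obtain r where r: "- \<epsilon> \<le> r" "r \<le> \<epsilon>" "cis s = cis (t + r)"
    by (auto simp: circle_arc_def cis_mult)
  then obtain n :: int where n: "s = t + r + 2 * pi * n"
    using sin_cos_eq_iff[of s "t + r"] by (auto simp: complex_eq_iff)
  have "\<bar>2 * pi * n\<bar> < 2 * pi * 1" using n r assms by (simp only: abs_less_iff) linarith
  then have "\<bar>real_of_int n\<bar> < 1" by (simp add: abs_mult)
  then have "n = 0" by linarith
  then show "s \<in> {t - \<epsilon>..t + \<epsilon>}" using n r by simp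
next
  assume "s \<in> {t - \<epsilon>..t + \<epsilon>}"
  then have "cis s = cis t * cis (s - t)" "s - t \<in> {- \<epsilon>..\<epsilon>}" by (auto simp: cis_mult)
  then show "cis s \<in> circle_arc (cis t) \<epsilon>" unfolding circle_arc_def by blast
qed

lemma arc_average_eq_window_average:
  assumes f: "f \<in> measurable circle_measure (restrict_space borel (sphere 0 1))"
    and g[measurable]: "g \<in> borel_measurable borel" and ae: "AE x in circle_measure. f x = g x"
    and \<epsilon>: "0 < \<epsilon>" "\<epsilon> < pi"
  shows "arc_average f \<epsilon> (cis t) = window_average (g \<circ> cis) \<epsilon> t"
proof -
  define A where "A = circle_arc (cis t) \<epsilon>"
  have "compact A" unfolding A_def circle_arc_def by (intro compact_continuous_image continuous_intros) auto
  then have A[measurable]: "A \<in> sets borel" by (simp add: borel_compact)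
  have iff: "cis s \<in> A \<longleftrightarrow> s \<in> {t - \<epsilon>..t + \<epsilon>}" if "s \<in> {t - pi..<t - pi + 2 * pi}" for s
    unfolding A_def using that \<epsilon> by (intro cis_mem_circle_arc_iff) auto
  have sub: "{t - \<epsilon>..t + \<epsilon>} \<subseteq> {t - pi..<t - pi + 2 * pi}" using \<epsilon> by auto
  have to_circle: "h \<in> borel_measurable borel \<Longrightarrow> h \<in> borel_measurable (arc_length a)"
    for h :: "complex \<Rightarrow> 'b::topological_space" and a
    unfolding arc_length_def by (auto intro: measurable_restrict_space1)
  have A_circle: "A \<in> sets circle_measure"
  proof -
    have "A \<subseteq> sphere 0 1" by (auto simp: A_def circle_arc_def norm_mult)
    then have "A \<in> sets (arc_length 0)"
      using A by (auto simp: arc_length_def sets_restrict_space intro!: image_eqI[of _ _ A])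
    then show ?thesis unfolding circle_measure_eq[of 0] by (rule sets_completionI_sets)
  qed
  have "emeasure circle_measure A = (\<integral>\<^sup>+ y. indicator A y \<partial>circle_measure)" using A_circle by simp
  also have "\<dots> = (\<integral>\<^sup>+ s\<in>{t - pi..<t - pi + 2 * pi}. indicator A (cis s) \<partial>lborel)"
    by (rule nn_integral_circle) auto
  also have "\<dots> = (\<integral>\<^sup>+ s. indicator {t - \<epsilon>..t + \<epsilon>} s \<partial>lborel)"
  proof (rule nn_integral_cong)
    fix s show "indicator A (cis s) * indicator {t - pi..<t - pi + 2 * pi} s = (indicator {t - \<epsilon>..t + \<epsilon>} s :: ennreal)"
      using iff[of s] sub by (cases "s \<in> {t - pi..<t - pi + 2 * pi}") (auto simp: indicator_def)
  qed
  also have "\<dots> = ennreal (2 * \<epsilon>)" using \<epsilon> by simp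
  finally have meas_A: "measure circle_measure A = 2 * \<epsilon>" using \<epsilon> by (simp add: measure_def)
  have f': "f \<in> borel_measurable circle_measure" using f by (simp add: measurable_restrict_space2_iff)
  have "(LINT y:A|circle_measure. f y) = (LINT y|circle_measure. indicator A y *\<^sub>R g y)"
    unfolding set_lebesgue_integral_def
  proof (rule integral_cong_AE)
    show "(\<lambda>y. indicator A y *\<^sub>R f y) \<in> borel_measurable circle_measure"
      using f' A_circle by (intro borel_measurable_scaleR borel_measurable_indicator)
    show "(\<lambda>y. indicator A y *\<^sub>R g y) \<in> borel_measurable circle_measure"
      unfolding circle_measure_eq[of 0] by (intro measurable_completion to_circle) measurable
    show "AE y in circle_measure. indicator A y *\<^sub>R f y = indicator A y *\<^sub>R g y"
      using ae by eventually_elim simp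
  qed
  also have "\<dots> = (LINT y|arc_length (t - pi). indicator A y *\<^sub>R g y)"
    unfolding circle_measure_eq[of "t - pi"] by (intro integral_completion to_circle) measurable
  also have "\<dots> = (LINT s|restrict_space lborel {t - pi..<t - pi + 2 * pi}. indicator A (cis s) *\<^sub>R g (cis s))"
    unfolding arc_length_def by (subst integral_distr) (auto intro!: measurable_restrict_space1)
  also have "\<dots> = (LINT s|lborel. indicator {t - pi..<t - pi + 2 * pi} s *\<^sub>R (indicator A (cis s) *\<^sub>R g (cis s)))"
    by (subst integral_restrict_space) auto
  also have "\<dots> = (LINT s:{t - \<epsilon>..t + \<epsilon>}|lborel. (g \<circ> cis) s)"
    unfolding set_lebesgue_integral_def
  proof (rule Bochner_Integration.integral_cong)
    fix s show "indicator {t - pi..<t - pi + 2 * pi} s *\<^sub>R (indicator A (cis s) *\<^sub>R g (cis s))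
        = indicator {t - \<epsilon>..t + \<epsilon>} s *\<^sub>R (g \<circ> cis) s"
      using iff[of s] sub by (cases "s \<in> {t - pi..<t - pi + 2 * pi}") (auto simp: indicator_def)
  qed simp
  finally show ?thesis unfolding arc_average_def window_average_def A_def[symmetric] by (simp add: meas_A comp_def)
qed

lemma circle_degree_eqI:
  assumes "winding_number (\<lambda>s. g (cis (2 * pi * s))) 0 = of_int n"
  shows "circle_degree g = n"
proof -
  have "g \<circ> circlepath 0 1 = (\<lambda>s. g (cis (2 * pi * s)))"
    by (auto simp: circlepath cis_conv_exp fun_eq_iff mult_ac)
  then show ?thesis unfolding circle_degree_def using assms by (intro the_equality) auto
qed

lemma vmo_degree_eqI:
  assumes "\<forall>\<^sub>F \<epsilon> in at_right 0. circle_degree (\<lambda>x. sgn (arc_average f \<epsilon> x)) = n"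
  shows "vmo_degree f = n"
  unfolding vmo_degree_def by (intro tendsto_Lim tendsto_eventually assms) simp

theorem theorem1p3:
  "\<exists>c::real. c > 0 \<and>
     (\<forall>p::real. 1 < p \<and> p \<le> 2 \<longrightarrow>
        (\<forall>f \<in> sobolev_circle_maps p.
           ennreal \<bar>real_of_int (vmo_degree f)\<bar> \<le> ennreal (c * (p - 1)) * sobolev_energy p f))"
proof (intro exI[of _ 704] conjI allI impI ballI)
  fix p :: real and f assume p: "1 < p \<and> p \<le> 2" and "f \<in> sobolev_circle_maps p"
  then have f: "f \<in> measurable circle_measure (restrict_space borel (sphere 0 1))"
    and fin: "sobolev_energy p f < \<infinity>" by (auto simp: sobolev_circle_maps_def)
  obtain g where g: "g \<in> borel_measurable borel" "\<And>x. norm (g x) = 1" and ae: "AE x in circle_measure. f x = g x"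
    using borel_unit_representative[OF f] by blast
  interpret unit_periodic "g \<circ> cis"
  proof
    show "g \<circ> cis \<in> borel_measurable borel" using borel_measurable_cis g(1) by (rule measurable_comp)
    show "(g \<circ> cis) (t + 2 * pi) = (g \<circ> cis) t" for t by (simp flip: cis_mult)
  qed (simp add: g)
  define W where "W = (\<integral>\<^sup>+ s\<in>{- pi..<pi}. diff_energy p (g \<circ> cis) s * ennreal (1 / s\<^sup>2) \<partial>lborel)"
  have W: "W \<le> sobolev_energy p f"
    unfolding W_def sobolev_energy_cong_AE[OF ae] using g p by (intro diff_energy_le_sobolev_energy) auto
  with fin have "W < \<infinity>" by (rule order.strict_trans1[rotated])
  then obtain e d where e: "0 < e" "e < pi"
    and d: "\<And>\<epsilon>. 0 < \<epsilon> \<Longrightarrow> \<epsilon> \<le> e \<Longrightarrow> winding_number (\<lambda>s. sgn (u \<epsilon> (2 * pi * s))) 0 = of_int d"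
    and bound: "ennreal \<bar>real_of_int d\<bar> \<le> ennreal (704 * (p - 1)) * W"
    by (rule degree_of_averages[OF conjunct1[OF p] conjunct2[OF p], folded W_def]) (rule that)
  have "vmo_degree f = d"
  proof (rule vmo_degree_eqI)
    have "\<forall>\<^sub>F \<epsilon> in at_right 0. \<epsilon> \<in> {0<..<e}"
      using e(1) by (rule eventually_at_right_real)
    then show "\<forall>\<^sub>F \<epsilon> in at_right 0. circle_degree (\<lambda>x. sgn (arc_average f \<epsilon> x)) = d"
    proof eventually_elim
      case (elim \<epsilon>)
      then have "arc_average f \<epsilon> (cis t) = u \<epsilon> t" for t
        using e by (intro arc_average_eq_window_average[OF f g(1) ae]) auto
      then show ?case using d[of \<epsilon>] elim by (intro circle_degree_eqI) simp
    qed
  qed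
  then have "ennreal \<bar>real_of_int (vmo_degree f)\<bar> \<le> ennreal (704 * (p - 1)) * W" using bound by simp
  also have "\<dots> \<le> ennreal (704 * (p - 1)) * sobolev_energy p f" using W by (rule mult_left_mono) simp
  finally show "ennreal \<bar>real_of_int (vmo_degree f)\<bar> \<le> ennreal (704 * (p - 1)) * sobolev_energy p f" .
qed simp

end
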